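(* Let $\xi\in\mathfrak{S}_+$. For each $t\in\mathbb{R}_+$ let $\xi_t=\xi_t^e+\xi_t^p$ with $\xi_t^e\in ca(\mathcal{A}_t,\mathcal{F})$ and $\xi_t^p\in pfa(\mathcal{A}_t,\mathcal{F})$, and set $\xi^e=(\xi_t^e)_{t\in\mathbb{R}_+}$ and $\xi^p=(\xi_t^p)_{t\in\mathbb{R}_+}$. Then $$\xi=\xi^e+\xi^p$$ is the unique decomposition of $\xi$ such that $\xi^e\in\mathfrak{S}_+$ may be represented as a classical $P$-supermartingale $X$ for some $P\in\mathbb{P}(\mathcal{F})$, while $\xi^p$ is positive and orthogonal to all finitely additive processes admitting such a representation.
   Context: $\Omega$ is a set, $(\mathcal{A}_t)_{t\in\mathbb{R}_+}$ an increasing family of algebras of subsets of $\Omega$, $\mathcal{A}=\bigcup_t\mathcal{A}_t$; $\mathcal{F}$ and $\mathcal{F}_t$ are the $\sigma$-algebras generated by $\mathcal{A}$ and $\mathcal{A}_t$. For an algebra $\mathcal{G}$, $ba(\mathcal{G})$ is the Banach lattice of bounded finitely additive real set functions on $\mathcal{G}$ (total variation norm); $\mathbb{P}(\mathcal{F})$ is the set of countably additive probability measures on $\mathcal{F}$. For algebras $\mathcal{G}\subset\mathcal{H}$, $ca(\mathcal{G},\mathcal{H})$ is the set of $\lambda\in ba(\mathcal{G})$ that admit a countably additive extension to $\mathcal{H}$, and $pfa(\mathcal{G},\mathcal{H})$ is the set of $\lambda\in ba(\mathcal{G})$ all of whose norm-preserving extensions to $\mathcal{H}$ are purely finitely additive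 (i.e. orthogonal to every countably additive element of $ba(\mathcal{H})$); every $\lambda\in ba(\mathcal{G})$ decomposes uniquely as a sum of an element of $ca(\mathcal{G},\mathcal{H})$ and an element of $pfa(\mathcal{G},\mathcal{H})$. A finitely additive process is an element $\xi=(\xi_t)_{t\in\mathbb{R}_+}$ of the vector lattice $\prod_t ba(\mathcal{A}_t)$ with coordinatewise order (orthogonality of processes is orthogonality in this lattice, i.e. coordinatewise). It is a finitely additive supermartingale if $\xi_t(F)\ge\xi_u(F)$ for $t\le u$, $F\in\mathcal{A}_t$; $\mathfrak{S}$ is the set of those with $\sup_t\|\xi_t\|<\infty$, and $\mathfrak{S}_+$ the set of positive elements of $\mathfrak{S}$. A finitely additive process $\eta$ is represented as a classical $P$-supermartingale $X$ if $P\in\mathbb{P}(\mathcal{F})$, $X=(X_t)_{t\in\mathbb{R}_+}$ is a $P$-supermartingale with respect to $(\mathcal{F}_t)_{t\in\mathbb{R}_+}$, and $\eta_t(F)=\int_F X_t\,dP$ for all $t\in\mathbb{R}_+$, $F\in\mathcal{A}_t$. *)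

theory Defs
  imports
    "HOL-Probability.Probability"
    "HOL-Algebra.Lattice"
    "HOL-Library.Function_Algebras"
begin

section \<open>Bounded finitely additive set functions\<close>

text \<open>
  Set functions on an algebra \<open>G\<close> are represented by total functions vanishing outside \<open>G\<close>.
  With this normalisation \<open>=\<close>, \<open>\<le>\<close>, \<open>+\<close>, unary minus and \<open>0\<close> on functions are
  exactly equality, the setwise order and the vector space operations of \<open>ba G\<close>.
\<close>

definition ba :: "'a set set \<Rightarrow> ('a set \<Rightarrow> real) set" where
  "ba G = {\<mu>. additive G \<mu> \<and> bounded (\<mu> ` G) \<and> (\<forall>E. E \<notin> G \<longrightarrow> \<mu> E = 0)}"

text \<open>The total variation norm of \<open>ba G\<close>.\<close>

definition tv_norm :: "'a set set \<Rightarrow> ('a set \<Rightarrow> real) \<Rightarrow> real" where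
  "tv_norm G \<mu> = Sup {\<Sum>E\<in>D. \<bar>\<mu> E\<bar> | D. finite D \<and> D \<subseteq> G \<and> disjoint D}"

text \<open>
  A set \<open>V\<close> of functions with the pointwise order. Joins and meets in it are those relative
  to the carrier \<open>V\<close>; in \<open>ba G\<close> they are not the pointwise maximum and minimum.
\<close>

definition pointwise_order :: "'b::ord set \<Rightarrow> 'b gorder" where
  "pointwise_order V = \<lparr>carrier = V, eq = (=), le = (\<le>)\<rparr>"

definition modulus :: "'b::{ord,uminus} set \<Rightarrow> 'b \<Rightarrow> 'b" where
  "modulus V x = x \<squnion>\<^bsub>pointwise_order V\<^esub> (- x)"

definition orthogonal_in :: "'b::{ord,uminus,zero} set \<Rightarrow> 'b \<Rightarrow> 'b \<Rightarrow> bool" where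
  "orthogonal_in V x y \<longleftrightarrow> modulus V x \<sqinter>\<^bsub>pointwise_order V\<^esub> modulus V y = 0"

text \<open>
  The countably additive and the purely finitely additive elements of \<open>ba H\<close>.
  (The library predicate \<open>countably_additive\<close> is restricted to \<open>ennreal\<close>-valued functions.)
\<close>

definition countably_additive_in :: "'a set set \<Rightarrow> ('a set \<Rightarrow> real) set" where
  "countably_additive_in H = {\<mu> \<in> ba H. \<forall>E :: nat \<Rightarrow> 'a set.
     range E \<subseteq> H \<longrightarrow> disjoint_family E \<longrightarrow> (\<Union>i. E i) \<in> H \<longrightarrow>
     (\<lambda>i. \<mu> (E i)) sums \<mu> (\<Union>i. E i)}"

definition purely_fin_additive_in :: "'a set set \<Rightarrow> ('a set \<Rightarrow> real) set" where
  "purely_fin_additive_in H =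
     {\<mu> \<in> ba H. \<forall>\<nu>\<in>countably_additive_in H. orthogonal_in (ba H) \<mu> \<nu>}"

definition ca :: "'a set set \<Rightarrow> 'a set set \<Rightarrow> ('a set \<Rightarrow> real) set" where
  "ca G H = {\<mu> \<in> ba G. \<exists>\<nu>\<in>countably_additive_in H. \<forall>E\<in>G. \<nu> E = \<mu> E}"

definition pfa :: "'a set set \<Rightarrow> 'a set set \<Rightarrow> ('a set \<Rightarrow> real) set" where
  "pfa G H = {\<mu> \<in> ba G. \<forall>\<nu>\<in>ba H.
     (\<forall>E\<in>G. \<nu> E = \<mu> E) \<longrightarrow> tv_norm H \<nu> = tv_norm G \<mu> \<longrightarrow> \<nu> \<in> purely_fin_additive_in H}"

section \<open>Finitely additive processes\<close>

text \<open>
  Families indexed by the nonnegative reals are functions on \<open>real\<close>, of which only the values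
  at arguments \<open>\<ge> 0\<close> matter; for processes the remaining values are set to \<open>0\<close>.
\<close>

definition increasing_algebras :: "'a set \<Rightarrow> (real \<Rightarrow> 'a set set) \<Rightarrow> bool" where
  "increasing_algebras \<Omega> A \<longleftrightarrow>
     (\<forall>t\<ge>0. algebra \<Omega> (A t)) \<and> (\<forall>s\<ge>0. \<forall>t\<ge>s. A s \<subseteq> A t)"

definition sigma_infinity :: "'a set \<Rightarrow> (real \<Rightarrow> 'a set set) \<Rightarrow> 'a set set" where
  "sigma_infinity \<Omega> A = sigma_sets \<Omega> (\<Union>t\<in>{0..}. A t)"

definition fa_processes :: "(real \<Rightarrow> 'a set set) \<Rightarrow> (real \<Rightarrow> 'a set \<Rightarrow> real) set" where
  "fa_processes A = {\<xi>. (\<forall>t\<ge>0. \<xi> t \<in> ba (A t)) \<and> (\<forall>t<0. \<xi> t = 0)}"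

definition fa_supermartingale ::
    "(real \<Rightarrow> 'a set set) \<Rightarrow> (real \<Rightarrow> 'a set \<Rightarrow> real) \<Rightarrow> bool" where
  "fa_supermartingale A \<xi> \<longleftrightarrow> \<xi> \<in> fa_processes A \<and>
     (\<forall>t\<ge>0. \<forall>u\<ge>t. \<forall>E\<in>A t. \<xi> t E \<ge> \<xi> u E)"

definition bounded_fa_supermartingales ::
    "(real \<Rightarrow> 'a set set) \<Rightarrow> (real \<Rightarrow> 'a set \<Rightarrow> real) set" (\<open>\<SS>\<close>) where
  "\<SS> A = {\<xi>. fa_supermartingale A \<xi> \<and> bdd_above ((\<lambda>t. tv_norm (A t) (\<xi> t)) ` {0..})}"

definition positive_bounded_fa_supermartingales ::
    "(real \<Rightarrow> 'a set set) \<Rightarrow> (real \<Rightarrow> 'a set \<Rightarrow> real) set" (\<open>\<SS>\<^sub>+\<close>) where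
  "\<SS>\<^sub>+ A = {\<xi> \<in> \<SS> A. 0 \<le> \<xi>}"

section \<open>Classical supermartingales and representation\<close>

definition supermartingale ::
    "'a measure \<Rightarrow> (real \<Rightarrow> 'a measure) \<Rightarrow> (real \<Rightarrow> 'a \<Rightarrow> real) \<Rightarrow> bool" where
  "supermartingale P \<F> X \<longleftrightarrow>
     (\<forall>t\<ge>0. X t \<in> borel_measurable (\<F> t) \<and> integrable P (X t)) \<and>
     (\<forall>s\<ge>0. \<forall>t\<ge>s. AE \<omega> in P. real_cond_exp P (\<F> s) (X t) \<omega> \<le> X s \<omega>)"

definition prob_measures :: "'a set \<Rightarrow> 'a set set \<Rightarrow> 'a measure set" where
  "prob_measures \<Omega> H = {P. prob_space P \<and> space P = \<Omega> \<and> sets P = H}"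

definition represented_as ::
    "'a set \<Rightarrow> (real \<Rightarrow> 'a set set) \<Rightarrow> (real \<Rightarrow> 'a set \<Rightarrow> real) \<Rightarrow>
     'a measure \<Rightarrow> (real \<Rightarrow> 'a \<Rightarrow> real) \<Rightarrow> bool" where
  "represented_as \<Omega> A \<eta> P X \<longleftrightarrow>
     P \<in> prob_measures \<Omega> (sigma_infinity \<Omega> A) \<and>
     supermartingale P (\<lambda>t. sigma \<Omega> (A t)) X \<and>
     (\<forall>t\<ge>0. \<forall>E\<in>A t. \<eta> t E = (LINT \<omega>:E|P. X t \<omega>))"

definition representable ::
    "'a set \<Rightarrow> (real \<Rightarrow> 'a set set) \<Rightarrow> (real \<Rightarrow> 'a set \<Rightarrow> real) \<Rightarrow> bool" where
  "representable \<Omega> A \<eta> \<longleftrightarrow> (\<exists>P X. represented_as \<Omega> A \<eta> P X)"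

definition classical_decomposition ::
    "'a set \<Rightarrow> (real \<Rightarrow> 'a set set) \<Rightarrow> (real \<Rightarrow> 'a set \<Rightarrow> real) \<Rightarrow>
     (real \<Rightarrow> 'a set \<Rightarrow> real) \<Rightarrow> (real \<Rightarrow> 'a set \<Rightarrow> real) \<Rightarrow> bool" where
  "classical_decomposition \<Omega> A \<xi> \<alpha> \<beta> \<longleftrightarrow>
     \<xi> = \<alpha> + \<beta> \<and>
     \<alpha> \<in> \<SS>\<^sub>+ A \<and> representable \<Omega> A \<alpha> \<and>
     \<beta> \<in> fa_processes A \<and> 0 \<le> \<beta> \<and>
     (\<forall>\<eta>\<in>fa_processes A. representable \<Omega> A \<eta> \<longrightarrow> orthogonal_in (fa_processes A) \<beta> \<eta>)"

end

theory Submission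
  imports Defs
begin

text \<open>
  Write \<open>\<F>\<close> for \<open>sigma_infinity \<Omega> A\<close>. Everything rests on two facts.

  The first is that \<open>ca (A t) \<F>\<close> and \<open>pfa (A t) \<F>\<close> are orthogonal in \<open>ba (A t)\<close>
  (\<open>pfa_orthogonal_ca\<close>). Otherwise, for some \<open>\<pi>\<close> in the second class (possibly after a change
  of sign) there would be a nonzero \<open>\<kappa> \<ge> 0\<close> below both \<open>\<pi>\<^sup>+\<close> and the restriction of a
  countably additive \<open>m\<close> on \<open>\<F>\<close>. A compactness argument extends \<open>\<kappa>\<close> to \<open>\<F>\<close> below \<open>m\<close>
  (\<open>dominated_extension\<close>), and being dominated by \<open>m\<close> forces this extension to be countably additive. Extending the rest of
  \<open>\<pi>\<^sup>+\<close> and \<open>\<pi>\<^sup>-\<close> arbitrarily but positively (\<open>positive_extension\<close>) produces a norm-preserving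
  extension of \<open>\<pi>\<close> with a countably additive part, which is a contradiction.

  Orthogonality is exploited through one inequality (\<open>le_of_le_plus_orthogonal\<close>): if
  \<open>\<alpha> \<le> \<beta> + \<pi>\<close> with \<open>\<alpha>\<close> orthogonal to \<open>\<pi>\<close> and \<open>\<beta> \<ge> 0\<close>, then \<open>\<alpha> \<le> \<beta>\<close>. It gives
  \<open>\<xi>\<^sub>e \<ge> 0\<close> and \<open>\<xi>\<^sub>p \<ge> 0\<close> (from \<open>- \<xi>\<^sub>e \<le> 0 + \<xi>\<^sub>p\<close> and its mirror image); it
  gives the supermartingale property of \<open>\<xi>\<^sub>e\<close>, because on \<open>A t\<close> one has
  \<open>\<xi>\<^sub>e u \<le> \<xi> u \<le> \<xi>\<^sub>e t + \<xi>\<^sub>p t\<close> for \<open>t \<le> u\<close>; and it gives uniqueness, because two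
  decompositions satisfy \<open>\<alpha> \<le> \<xi>\<^sub>e + \<xi>\<^sub>p\<close> and \<open>\<xi>\<^sub>e \<le> \<alpha> + \<beta>\<close>.

  The second fact is that a positive finitely additive supermartingale whose coordinates lie in
  \<open>ca (A t) \<F>\<close> is representable (\<open>representable_supermartingale\<close>). Its coordinates extend to
  measures on the \<open>\<sigma>\<close>-algebras generated by the \<open>A t\<close>, and their densities form the
  supermartingale once one probability dominates them all. Countably many times suffice for that,
  since the decreasing total mass has only countably many discontinuities. Conversely the
  coordinates of representable processes lie in \<open>ca (A t) \<F>\<close> (\<open>ca_of_represented_as\<close>), so
  the orthogonality of \<open>\<xi>\<^sub>p\<close> to these processes is an instance of the first fact.
\<close>

section \<open>The lattice of bounded finitely additive set functions\<close>

text \<open>The positive part \<open>\<mu> \<squnion> 0\<close> in the lattice \<open>ba G\<close>, by the Riesz formula.\<close>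
definition pos_var :: "'a set set \<Rightarrow> ('a set \<Rightarrow> real) \<Rightarrow> 'a set \<Rightarrow> real" where
  "pos_var G \<mu> E = (if E \<in> G then \<Squnion>F\<in>{F \<in> G. F \<subseteq> E}. \<mu> F else 0)"

definition variation :: "'a set set \<Rightarrow> ('a set \<Rightarrow> real) \<Rightarrow> 'a set \<Rightarrow> real" where
  "variation G \<mu> = pos_var G \<mu> + pos_var G (- \<mu>)"

lemma ba_outside: "\<mu> \<in> ba G \<Longrightarrow> E \<notin> G \<Longrightarrow> \<mu> E = 0"
  by (simp add: ba_def)

lemma ba_additive: "\<mu> \<in> ba G \<Longrightarrow> E \<in> G \<Longrightarrow> F \<in> G \<Longrightarrow> E \<inter> F = {} \<Longrightarrow> \<mu> (E \<union> F) = \<mu> E + \<mu> F"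
  by (simp add: ba_def additive_def)

lemma ba_le_iff:
  assumes "\<mu> \<in> ba G" "\<nu> \<in> ba G"
  shows "\<mu> \<le> \<nu> \<longleftrightarrow> (\<forall>E\<in>G. \<mu> E \<le> \<nu> E)"
  using assms by (auto simp: le_fun_def ba_def)

lemma ba_0: "0 \<in> ba G"
  by (auto simp: ba_def additive_def bounded_iff)

lemma ba_uminus: "\<mu> \<in> ba G \<Longrightarrow> - \<mu> \<in> ba G"
  by (auto simp: ba_def additive_def bounded_iff)

lemma ba_plus:
  assumes "\<mu> \<in> ba G" "\<nu> \<in> ba G"
  shows "\<mu> + \<nu> \<in> ba G"
proof -
  obtain a b where "\<forall>E\<in>G. \<bar>\<mu> E\<bar> \<le> a" "\<forall>E\<in>G. \<bar>\<nu> E\<bar> \<le> b"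
    using assms by (auto simp: ba_def bounded_iff)
  then have "\<forall>E\<in>G. \<bar>\<mu> E + \<nu> E\<bar> \<le> a + b"
    by (meson abs_triangle_ineq add_mono order_trans)
  then show ?thesis
    using assms by (auto simp: ba_def additive_def bounded_iff)
qed

lemma ba_minus: "\<mu> \<in> ba G \<Longrightarrow> \<nu> \<in> ba G \<Longrightarrow> \<mu> - \<nu> \<in> ba G"
  using ba_plus[of \<mu> G "- \<nu>"] ba_uminus[of \<nu> G] by simp

lemma pos_var_outside: "E \<notin> G \<Longrightarrow> pos_var G \<mu> E = 0"
  by (simp add: pos_var_def)

lemma pos_var_upper:
  assumes "\<mu> \<in> ba G" "E \<in> G" "F \<in> G" "F \<subseteq> E"
  shows "\<mu> F \<le> pos_var G \<mu> E"
proof -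
  have "bounded (\<mu> ` G)" using assms(1) by (simp add: ba_def)
  then have "bounded (\<mu> ` {F \<in> G. F \<subseteq> E})" by (rule bounded_subset) auto
  then have "bdd_above (\<mu> ` {F \<in> G. F \<subseteq> E})" by (rule bounded_imp_bdd_above)
  then show ?thesis
    using assms by (auto simp: pos_var_def intro!: cSUP_upper)
qed

lemma pos_var_least:
  assumes "E \<in> G" "\<And>F. F \<in> G \<Longrightarrow> F \<subseteq> E \<Longrightarrow> \<mu> F \<le> c"
  shows "pos_var G \<mu> E \<le> c"
  using assms by (auto simp: pos_var_def intro!: cSUP_least)

lemma pos_var_approx:
  assumes "E \<in> G" "\<epsilon> > 0"
  obtains F where "F \<in> G" "F \<subseteq> E" "pos_var G \<mu> E - \<epsilon> < \<mu> F"
proof -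
  have "\<exists>F\<in>G. F \<subseteq> E \<and> pos_var G \<mu> E - \<epsilon> < \<mu> F"
  proof (rule ccontr)
    assume "\<not> ?thesis"
    then have "pos_var G \<mu> E \<le> pos_var G \<mu> E - \<epsilon>"
      using assms(1) by (intro pos_var_least) force+
    then show False using \<open>\<epsilon> > 0\<close> by simp
  qed
  then show ?thesis using that by blast
qed

context algebra
begin

lemma ba_empty: "\<mu> \<in> ba M \<Longrightarrow> \<mu> {} = 0"
  using ba_additive[of \<mu> M "{}" "{}"] by simp

lemma ba_Diff:
  assumes "\<mu> \<in> ba M" "E \<in> M" "F \<in> M" "F \<subseteq> E"
  shows "\<mu> (E - F) = \<mu> E - \<mu> F"
proof -
  have "F \<union> (E - F) = E" using assms by blast
  then show ?thesis
    using ba_additive[OF assms(1,3) Diff[OF assms(2,3)]] by auto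
qed

lemma ba_split:
  assumes "\<mu> \<in> ba M" "E \<in> M" "F \<in> M"
  shows "\<mu> E = \<mu> (E \<inter> F) + \<mu> (E - F)"
proof -
  have "(E \<inter> F) \<union> (E - F) = E" "(E \<inter> F) \<inter> (E - F) = {}" by auto
  then show ?thesis
    using ba_additive[of \<mu> M "E \<inter> F" "E - F"] assms by auto
qed

lemma ba_mono:
  assumes "\<mu> \<in> ba M" "0 \<le> \<mu>" "E \<in> M" "F \<in> M" "F \<subseteq> E"
  shows "\<mu> F \<le> \<mu> E"
proof -
  have "0 \<le> \<mu> (E - F)" using assms(2) by (simp add: le_fun_def)
  then show ?thesis using ba_Diff[OF assms(1,3-5)] by simp
qed

lemma pos_var_nonneg:
  assumes "\<mu> \<in> ba M"
  shows "0 \<le> pos_var M \<mu>"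
proof (unfold le_fun_def, intro allI)
  fix E show "0 E \<le> pos_var M \<mu> E"
    using pos_var_upper[OF assms, of E "{}"] ba_empty[OF assms] pos_var_outside[of E M \<mu>]
    by (cases "E \<in> M") auto
qed

lemma pos_var_ba:
  assumes \<mu>: "\<mu> \<in> ba M"
  shows "pos_var M \<mu> \<in> ba M"
proof -
  obtain B where B: "\<And>E. E \<in> M \<Longrightarrow> \<bar>\<mu> E\<bar> \<le> B"
    using \<mu> by (auto simp: ba_def bounded_iff)
  have bnd: "\<bar>pos_var M \<mu> E\<bar> \<le> B" if "E \<in> M" for E
  proof -
    have "pos_var M \<mu> E \<le> B"
      using B by (intro pos_var_least that) (meson abs_le_D1)
    then show ?thesis using pos_var_nonneg[OF \<mu>] by (simp add: le_fun_def)
  qed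
  have add: "pos_var M \<mu> (E \<union> F) = pos_var M \<mu> E + pos_var M \<mu> F"
    if EF: "E \<in> M" "F \<in> M" "E \<inter> F = {}" for E F
  proof (rule antisym)
    show "pos_var M \<mu> (E \<union> F) \<le> pos_var M \<mu> E + pos_var M \<mu> F"
    proof (rule pos_var_least)
      fix K assume K: "K \<in> M" "K \<subseteq> E \<union> F"
      then have "K \<inter> E \<in> M" "K - E \<in> M" "K - E \<subseteq> F" using EF by auto
      then have "\<mu> (K \<inter> E) \<le> pos_var M \<mu> E" "\<mu> (K - E) \<le> pos_var M \<mu> F"
        using EF by (auto intro!: pos_var_upper[OF \<mu>])
      then show "\<mu> K \<le> pos_var M \<mu> E + pos_var M \<mu> F"
        using ba_split[OF \<mu> K(1) EF(1)] by simp
    qed (use EF in auto)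
  next
    show "pos_var M \<mu> E + pos_var M \<mu> F \<le> pos_var M \<mu> (E \<union> F)"
    proof (rule field_le_epsilon)
      fix \<epsilon> :: real assume "\<epsilon> > 0"
      then have e: "\<epsilon> / 2 > 0" by simp
      obtain K where K: "K \<in> M" "K \<subseteq> E" "pos_var M \<mu> E - \<epsilon> / 2 < \<mu> K"
        using pos_var_approx[OF EF(1) e] .
      obtain L where L: "L \<in> M" "L \<subseteq> F" "pos_var M \<mu> F - \<epsilon> / 2 < \<mu> L"
        using pos_var_approx[OF EF(2) e] .
      have "K \<inter> L = {}" using K L EF by blast
      then have "\<mu> K + \<mu> L = \<mu> (K \<union> L)" using ba_additive[OF \<mu> K(1) L(1)] by simp
      also have "\<dots> \<le> pos_var M \<mu> (E \<union> F)"
        using K L EF by (intro pos_var_upper[OF \<mu>]) auto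
      finally show "pos_var M \<mu> E + pos_var M \<mu> F \<le> pos_var M \<mu> (E \<union> F) + \<epsilon>"
        using K(3) L(3) by argo
    qed
  qed
  have "bounded (pos_var M \<mu> ` M)"
    using bnd by (auto simp: bounded_iff)
  then show ?thesis
    using add by (auto simp: ba_def additive_def pos_var_outside)
qed

text \<open>Passing to relative complements: \<open>- \<mu> F = \<mu> (E - F) - \<mu> E\<close> for \<open>F \<subseteq> E\<close>.\<close>
lemma pos_var_uminus:
  assumes \<mu>: "\<mu> \<in> ba M"
  shows "pos_var M (- \<mu>) = pos_var M \<mu> - \<mu>"
proof
  fix E
  have le: "pos_var M (- \<nu>) E \<le> pos_var M \<nu> E - \<nu> E" if E: "E \<in> M" and \<nu>: "\<nu> \<in> ba M" for \<nu>
  proof (rule pos_var_least[OF E])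
    fix F assume F: "F \<in> M" "F \<subseteq> E"
    have "\<nu> (E - F) \<le> pos_var M \<nu> E"
      using E F by (intro pos_var_upper[OF \<nu>]) auto
    then show "(- \<nu>) F \<le> pos_var M \<nu> E - \<nu> E"
      using ba_Diff[OF \<nu> E F] by simp
  qed
  show "pos_var M (- \<mu>) E = (pos_var M \<mu> - \<mu>) E"
  proof (cases "E \<in> M")
    case True
    with le[OF True \<mu>] le[OF True ba_uminus[OF \<mu>]] show ?thesis by simp
  next
    case False
    then show ?thesis using \<mu> by (simp add: pos_var_outside ba_outside)
  qed
qed

lemma variation_ba: "\<mu> \<in> ba M \<Longrightarrow> variation M \<mu> \<in> ba M"
  unfolding variation_def by (intro ba_plus pos_var_ba ba_uminus)

lemma variation_nonneg: "\<mu> \<in> ba M \<Longrightarrow> 0 \<le> variation M \<mu>"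
  using pos_var_nonneg[of \<mu>] pos_var_nonneg[OF ba_uminus, of \<mu>]
  by (auto simp: variation_def le_fun_def)

lemma variation_uminus [simp]: "variation M (- \<mu>) = variation M \<mu>"
  by (simp add: variation_def add.commute)

lemma le_variation:
  assumes "\<mu> \<in> ba M"
  shows "\<mu> \<le> variation M \<mu>"
  using pos_var_uminus[OF assms] pos_var_nonneg[OF ba_uminus[OF assms]]
    pos_var_nonneg[OF assms]
  by (auto simp: variation_def le_fun_def)

lemma abs_le_variation:
  assumes "\<mu> \<in> ba M"
  shows "\<bar>\<mu> E\<bar> \<le> variation M \<mu> E"
  using le_variation[OF assms] le_variation[OF ba_uminus[OF assms]]
  by (auto simp: le_fun_def abs_le_iff)

text \<open>
  A bound \<open>c\<close> need only control \<open>\<mu>\<close> on pairs of disjoint subsets of \<open>E\<close>, because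
  \<open>\<mu> F - \<mu> K = \<mu> (F - K) - \<mu> (K - F)\<close>.
\<close>
lemma variation_le:
  assumes \<mu>: "\<mu> \<in> ba M" and E: "E \<in> M"
    and c: "\<And>F K. F \<in> M \<Longrightarrow> K \<in> M \<Longrightarrow> F \<subseteq> E \<Longrightarrow> K \<subseteq> E \<Longrightarrow> F \<inter> K = {} \<Longrightarrow> \<mu> F - \<mu> K \<le> c"
  shows "variation M \<mu> E \<le> c"
proof -
  have *: "\<mu> F - \<mu> K \<le> c" if "F \<in> M" "F \<subseteq> E" "K \<in> M" "K \<subseteq> E" for F K
  proof -
    have "\<mu> (F - K) - \<mu> (K - F) \<le> c" using that by (intro c) auto
    moreover have "F \<inter> K = K \<inter> F" by auto
    ultimately show ?thesis
      using ba_split[OF \<mu> that(1,3)] ba_split[OF \<mu> that(3,1)] by simp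
  qed
  have "pos_var M (- \<mu>) E \<le> c - \<mu> F" if "F \<in> M" "F \<subseteq> E" for F
    using *[OF that] by (intro pos_var_least E) force
  then have "pos_var M \<mu> E \<le> c - pos_var M (- \<mu>) E"
    by (intro pos_var_least E) force
  then show ?thesis by (simp add: variation_def)
qed

lemma variation_least:
  assumes "\<mu> \<in> ba M" "\<nu> \<in> ba M" "\<mu> \<le> \<nu>" "- \<mu> \<le> \<nu>"
  shows "variation M \<mu> \<le> \<nu>"
proof -
  have "0 \<le> \<nu>"
    unfolding le_fun_def
  proof
    fix E show "0 E \<le> \<nu> E"
      using le_funD[OF assms(3), of E] le_funD[OF assms(4), of E] by simp
  qed
  have "variation M \<mu> E \<le> \<nu> E" if E: "E \<in> M" for E
  proof (rule variation_le[OF assms(1) E])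
    fix F K assume FK: "F \<in> M" "K \<in> M" "F \<subseteq> E" "K \<subseteq> E" "F \<inter> K = {}"
    have "\<mu> F - \<mu> K \<le> \<nu> F + \<nu> K"
      using le_funD[OF assms(3), of F] le_funD[OF assms(4), of K] by simp
    also have "\<dots> = \<nu> (F \<union> K)"
      using FK by (simp add: ba_additive[OF assms(2)])
    also have "\<dots> \<le> \<nu> E"
      using FK E by (intro ba_mono[OF assms(2) \<open>0 \<le> \<nu>\<close>]) auto
    finally show "\<mu> F - \<mu> K \<le> \<nu> E" .
  qed
  then show ?thesis
    using ba_le_iff[OF variation_ba[OF assms(1)] assms(2)] by blast
qed

lemma variation_of_nonneg:
  assumes "\<mu> \<in> ba M" "0 \<le> \<mu>"
  shows "variation M \<mu> = \<mu>"
proof (rule antisym)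
  have "- \<mu> \<le> \<mu>"
    unfolding le_fun_def
  proof
    fix E show "(- \<mu>) E \<le> \<mu> E" using le_funD[OF assms(2), of E] by simp
  qed
  then show "variation M \<mu> \<le> \<mu>" using assms by (intro variation_least) auto
qed (rule le_variation[OF assms(1)])

end

lemma join_pointwise_order_eqI:
  fixes x y z :: "'b::order"
  assumes "x \<in> V" "y \<in> V" "z \<in> V" "x \<le> z" "y \<le> z"
    and "\<And>w. w \<in> V \<Longrightarrow> x \<le> w \<Longrightarrow> y \<le> w \<Longrightarrow> z \<le> w"
  shows "x \<squnion>\<^bsub>pointwise_order V\<^esub> y = z"
proof -
  have "least (pointwise_order V) u (Upper (pointwise_order V) {x, y}) \<longleftrightarrow> u = z" for u
    using assms by (auto simp: least_def Upper_def pointwise_order_def intro: antisym)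
  then show ?thesis by (simp add: join_def sup_def)
qed

lemma meet_pointwise_order_eqI:
  fixes x y z :: "'b::order"
  assumes "x \<in> V" "y \<in> V" "z \<in> V" "z \<le> x" "z \<le> y"
    and "\<And>w. w \<in> V \<Longrightarrow> w \<le> x \<Longrightarrow> w \<le> y \<Longrightarrow> w \<le> z"
  shows "x \<sqinter>\<^bsub>pointwise_order V\<^esub> y = z"
proof -
  have "greatest (pointwise_order V) u (Lower (pointwise_order V) {x, y}) \<longleftrightarrow> u = z" for u
    using assms by (auto simp: greatest_def Lower_def pointwise_order_def intro: antisym)
  then show ?thesis by (simp add: meet_def inf_def)
qed

text \<open>The meet in \<open>ba G\<close>, from the identity \<open>\<mu> \<sqinter> \<nu> = \<mu> - (\<mu> - \<nu>)\<^sup>+\<close> of vector lattices.\<close>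
definition ba_inf :: "'a set set \<Rightarrow> ('a set \<Rightarrow> real) \<Rightarrow> ('a set \<Rightarrow> real) \<Rightarrow> 'a set \<Rightarrow> real" where
  "ba_inf G \<mu> \<nu> = \<mu> - pos_var G (\<mu> - \<nu>)"

context algebra
begin

lemma ba_inf_ba: "\<mu> \<in> ba M \<Longrightarrow> \<nu> \<in> ba M \<Longrightarrow> ba_inf M \<mu> \<nu> \<in> ba M"
  unfolding ba_inf_def by (intro ba_minus pos_var_ba)

lemma ba_inf_le:
  assumes "\<mu> \<in> ba M" "\<nu> \<in> ba M"
  shows "ba_inf M \<mu> \<nu> \<le> \<mu>" "ba_inf M \<mu> \<nu> \<le> \<nu>"
proof -
  note d = ba_minus[OF assms]
  show "ba_inf M \<mu> \<nu> \<le> \<mu>"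
    using pos_var_nonneg[OF d] by (auto simp: ba_inf_def le_fun_def)
  have "0 \<le> pos_var M (\<mu> - \<nu>) - (\<mu> - \<nu>)"
    using pos_var_nonneg[OF ba_uminus[OF d]] pos_var_uminus[OF d] by simp
  then show "ba_inf M \<mu> \<nu> \<le> \<nu>"
    by (auto simp: ba_inf_def le_fun_def algebra_simps)
qed

lemma ba_inf_greatest:
  assumes "\<mu> \<in> ba M" "\<nu> \<in> ba M" "\<kappa> \<in> ba M" "\<kappa> \<le> \<mu>" "\<kappa> \<le> \<nu>"
  shows "\<kappa> \<le> ba_inf M \<mu> \<nu>"
proof -
  have "pos_var M (\<mu> - \<nu>) E \<le> \<mu> E - \<kappa> E" if E: "E \<in> M" for E
  proof (rule pos_var_least[OF E])
    fix F assume F: "F \<in> M" "F \<subseteq> E"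
    have "0 \<le> \<mu> - \<kappa>" using assms(4) by (simp add: le_fun_def)
    then have "(\<mu> - \<kappa>) F \<le> (\<mu> - \<kappa>) E"
      using ba_mono[OF ba_minus[OF assms(1,3)]] E F by blast
    then show "(\<mu> - \<nu>) F \<le> \<mu> E - \<kappa> E"
      using le_funD[OF assms(5), of F] by simp
  qed
  then show ?thesis
    by (subst ba_le_iff[OF assms(3) ba_inf_ba[OF assms(1,2)]]) (auto simp: ba_inf_def algebra_simps)
qed

lemma modulus_ba: "\<mu> \<in> ba M \<Longrightarrow> modulus (ba M) \<mu> = variation M \<mu>"
  unfolding modulus_def
  using le_variation[of \<mu>] le_variation[OF ba_uminus, of \<mu>]
  by (intro join_pointwise_order_eqI ba_uminus variation_ba variation_least) auto

lemma orthogonal_in_ba_iff_inf: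
  assumes "\<mu> \<in> ba M" "\<nu> \<in> ba M"
  shows "orthogonal_in (ba M) \<mu> \<nu> \<longleftrightarrow> ba_inf M (variation M \<mu>) (variation M \<nu>) = 0"
proof -
  note v = assms[THEN variation_ba]
  have "variation M \<mu> \<sqinter>\<^bsub>pointwise_order (ba M)\<^esub> variation M \<nu>
      = ba_inf M (variation M \<mu>) (variation M \<nu>)"
    by (intro meet_pointwise_order_eqI v ba_inf_ba ba_inf_le ba_inf_greatest)
  then show ?thesis by (simp add: orthogonal_in_def modulus_ba assms)
qed

text \<open>
  The form in which orthogonality is used below: up to \<open>\<epsilon>\<close>, the two variations live on
  complementary members of the algebra. It holds because the meet at \<open>\<Omega>\<close> is
  the infimum of \<open>\<bar>\<mu>\<bar> F + \<bar>\<nu>\<bar> (\<Omega> - F)\<close>.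
\<close>
lemma orthogonal_in_ba_iff:
  assumes "\<mu> \<in> ba M" "\<nu> \<in> ba M"
  shows "orthogonal_in (ba M) \<mu> \<nu> \<longleftrightarrow>
    (\<forall>\<epsilon>>0. \<exists>F\<in>M. variation M \<mu> F + variation M \<nu> (\<Omega> - F) < \<epsilon>)"
    (is "_ \<longleftrightarrow> ?R")
proof -
  let ?a = "variation M \<mu>" and ?b = "variation M \<nu>"
  note v = assms[THEN variation_ba]
  have "?R" if "ba_inf M ?a ?b = 0"
  proof (intro allI impI)
    fix \<epsilon> :: real assume e: "\<epsilon> > 0"
    obtain F where F: "F \<in> M" "pos_var M (?a - ?b) \<Omega> - \<epsilon> < (?a - ?b) F"
      using pos_var_approx[OF top e, of "?a - ?b"] by metis
    have "pos_var M (?a - ?b) \<Omega> = ?a \<Omega>"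
      using fun_cong[OF that, of \<Omega>] by (simp add: ba_inf_def)
    moreover have "?a (\<Omega> - F) = ?a \<Omega> - ?a F"
      using F sets_into_space by (intro ba_Diff[OF v(1)]) auto
    moreover have "\<Omega> - (\<Omega> - F) = F" using F(1) sets_into_space by blast
    ultimately show "\<exists>F\<in>M. ?a F + ?b (\<Omega> - F) < \<epsilon>"
      using F by (intro bexI[of _ "\<Omega> - F"]) auto
  qed
  moreover have "ba_inf M ?a ?b = 0" if R: ?R
  proof -
    let ?k = "ba_inf M ?a ?b"
    note k = ba_inf_ba[OF v]
    have pos: "0 \<le> ?k"
      using variation_nonneg[OF assms(1)] variation_nonneg[OF assms(2)]
      by (intro ba_inf_greatest v ba_0)
    have "?k \<Omega> \<le> 0"
    proof (rule field_le_epsilon)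
      fix \<epsilon> :: real assume "\<epsilon> > 0"
      then obtain F where F: "F \<in> M" "?a F + ?b (\<Omega> - F) < \<epsilon>" using R by blast
      have "?k \<Omega> = ?k F + ?k (\<Omega> - F)"
        using ba_Diff[OF k top F(1)] F(1) sets_into_space by auto
      also have "\<dots> \<le> ?a F + ?b (\<Omega> - F)"
        using ba_inf_le[OF v] by (intro add_mono) (auto simp: le_fun_def)
      finally show "?k \<Omega> \<le> 0 + \<epsilon>" using F by simp
    qed
    then have "?k E = 0" for E
      using ba_mono[OF k pos top, of E] pos ba_outside[OF k, of E] sets_into_space[of E]
      by (cases "E \<in> M") (auto simp: le_fun_def intro: antisym order_trans)
    then show ?thesis by (simp add: fun_eq_iff)
  qed
  ultimately show ?thesis using orthogonal_in_ba_iff_inf[OF assms] by blast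
qed

lemma orthogonal_in_ba_sym:
  assumes "\<mu> \<in> ba M" "\<nu> \<in> ba M" "orthogonal_in (ba M) \<mu> \<nu>"
  shows "orthogonal_in (ba M) \<nu> \<mu>"
  unfolding orthogonal_in_ba_iff[OF assms(2,1)]
proof (intro allI impI)
  fix \<epsilon> :: real assume "\<epsilon> > 0"
  then obtain F where F: "F \<in> M" "variation M \<mu> F + variation M \<nu> (\<Omega> - F) < \<epsilon>"
    using assms orthogonal_in_ba_iff by blast
  moreover have "\<Omega> - (\<Omega> - F) = F" using F(1) sets_into_space by blast
  ultimately show "\<exists>F\<in>M. variation M \<nu> F + variation M \<mu> (\<Omega> - F) < \<epsilon>"
    by (intro bexI[of _ "\<Omega> - F"]) auto
qed

lemma orthogonal_in_ba_uminus:
  assumes "\<mu> \<in> ba M" "\<nu> \<in> ba M"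
  shows "orthogonal_in (ba M) (- \<mu>) \<nu> \<longleftrightarrow> orthogonal_in (ba M) \<mu> \<nu>"
  using assms by (simp add: orthogonal_in_ba_iff ba_uminus)

text \<open>
  Split \<open>E\<close> along a set \<open>F\<close> that almost separates \<open>\<alpha>\<close> from \<open>\<pi>\<close>: inside \<open>F\<close> there is hardly any
  \<open>\<alpha>\<close>, outside \<open>F\<close> hardly any \<open>\<pi>\<close>. Positivity of both parts of the decomposition, the
  supermartingale property of the first part, and uniqueness are all instances.
\<close>
lemma le_of_le_plus_orthogonal:
  assumes \<alpha>: "\<alpha> \<in> ba M" and \<beta>: "\<beta> \<in> ba M" "0 \<le> \<beta>" and \<pi>: "\<pi> \<in> ba M"
    and orth: "orthogonal_in (ba M) \<alpha> \<pi>"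
    and le: "\<And>E. E \<in> M \<Longrightarrow> \<alpha> E \<le> \<beta> E + \<pi> E"
  shows "\<alpha> \<le> \<beta>"
proof -
  have "\<alpha> E \<le> \<beta> E" if E: "E \<in> M" for E
  proof (rule field_le_epsilon)
    fix \<epsilon> :: real assume "\<epsilon> > 0"
    then obtain F where F: "F \<in> M" "variation M \<alpha> F + variation M \<pi> (\<Omega> - F) < \<epsilon>"
      using orth orthogonal_in_ba_iff[OF \<alpha> \<pi>] by blast
    have "\<alpha> (E \<inter> F) \<le> variation M \<alpha> (E \<inter> F)"
      using le_variation[OF \<alpha>] by (simp add: le_fun_def)
    also have "\<dots> \<le> variation M \<alpha> F"
      using E F by (intro ba_mono variation_ba variation_nonneg \<alpha>) auto
    finally have 1: "\<alpha> (E \<inter> F) \<le> variation M \<alpha> F" .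
    have "\<pi> (E - F) \<le> variation M \<pi> (E - F)"
      using le_variation[OF \<pi>] by (simp add: le_fun_def)
    also have "\<dots> \<le> variation M \<pi> (\<Omega> - F)"
      using E F sets_into_space by (intro ba_mono variation_ba variation_nonneg \<pi>) auto
    finally have 2: "\<pi> (E - F) \<le> variation M \<pi> (\<Omega> - F)" .
    have "\<alpha> (E - F) \<le> \<beta> (E - F) + \<pi> (E - F)" using E F by (intro le) auto
    moreover have "\<beta> (E - F) \<le> \<beta> E" using E F by (intro ba_mono \<beta>) auto
    ultimately show "\<alpha> E \<le> \<beta> E + \<epsilon>"
      using 1 2 F(2) ba_split[OF \<alpha> E F(1)] by linarith
  qed
  then show ?thesis using ba_le_iff[OF \<alpha> \<beta>(1)] by blast
qed

end

section \<open>The lattice of finitely additive processes\<close>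

lemma modulus_fa_processes:
  assumes alg: "\<And>t. t \<ge> 0 \<Longrightarrow> algebra \<Omega> (A t)" and \<xi>: "\<xi> \<in> fa_processes A"
  shows "modulus (fa_processes A) \<xi> = (\<lambda>t. if t \<ge> 0 then variation (A t) (\<xi> t) else 0)"
    (is "_ = ?v")
proof -
  have ba: "\<xi> t \<in> ba (A t)" if "t \<ge> 0" for t using \<xi> that by (simp add: fa_processes_def)
  have 0: "\<xi> t = 0" if "t < 0" for t using \<xi> that by (simp add: fa_processes_def)
  show ?thesis
    unfolding modulus_def
  proof (rule join_pointwise_order_eqI)
    show "- \<xi> \<in> fa_processes A" using ba 0 by (simp add: fa_processes_def ba_uminus)
    show "?v \<in> fa_processes A"
      using ba by (simp add: fa_processes_def algebra.variation_ba[OF alg])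
    show "\<xi> \<le> ?v" using ba 0 algebra.le_variation[OF alg] by (subst le_fun_def) force
    show "- \<xi> \<le> ?v"
      using ba 0 algebra.le_variation[OF alg ba_uminus] algebra.variation_uminus[OF alg]
      by (subst le_fun_def) force
    fix w assume w: "w \<in> fa_processes A" "\<xi> \<le> w" "- \<xi> \<le> w"
    have "?v t \<le> w t" for t
    proof (cases "t \<ge> 0")
      case True
      then show ?thesis
        using w ba algebra.variation_least[OF alg, of t "\<xi> t" "w t"] le_funD[OF w(2), of t]
          le_funD[OF w(3), of t]
        by (simp add: fa_processes_def)
    next
      case False
      then show ?thesis using w by (simp add: fa_processes_def)
    qed
    then show "?v \<le> w" by (simp add: le_fun_def)
  qed (rule \<xi>)
qed

lemma orthogonal_in_fa_processes_iff:
  assumes alg: "\<And>t. t \<ge> 0 \<Longrightarrow> algebra \<Omega> (A t)"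
    and \<xi>: "\<xi> \<in> fa_processes A" and \<eta>: "\<eta> \<in> fa_processes A"
  shows "orthogonal_in (fa_processes A) \<xi> \<eta> \<longleftrightarrow> (\<forall>t\<ge>0. orthogonal_in (ba (A t)) (\<xi> t) (\<eta> t))"
proof -
  let ?a = "\<lambda>t. if t \<ge> 0 then variation (A t) (\<xi> t) else 0"
  let ?b = "\<lambda>t. if t \<ge> 0 then variation (A t) (\<eta> t) else 0"
  let ?k = "\<lambda>t. if t \<ge> 0 then ba_inf (A t) (variation (A t) (\<xi> t)) (variation (A t) (\<eta> t)) else 0"
  have ba: "\<xi> t \<in> ba (A t)" "\<eta> t \<in> ba (A t)" if "t \<ge> 0" for t
    using \<xi> \<eta> that by (simp_all add: fa_processes_def)
  have v: "variation (A t) (\<xi> t) \<in> ba (A t)" "variation (A t) (\<eta> t) \<in> ba (A t)" if "t \<ge> 0" for t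
    using algebra.variation_ba[OF alg] ba that by blast+
  have "?a \<sqinter>\<^bsub>pointwise_order (fa_processes A)\<^esub> ?b = ?k"
  proof (rule meet_pointwise_order_eqI)
    show "?a \<in> fa_processes A" "?b \<in> fa_processes A" "?k \<in> fa_processes A"
      using v by (simp_all add: fa_processes_def algebra.ba_inf_ba[OF alg])
    show "?k \<le> ?a" "?k \<le> ?b"
      using v algebra.ba_inf_le[OF alg] by (auto simp: le_fun_def[of ?k])
    fix w assume w: "w \<in> fa_processes A" "w \<le> ?a" "w \<le> ?b"
    have "w t \<le> ?k t" for t
      using w(1) v algebra.ba_inf_greatest[OF alg, of t _ _ "w t"]
        le_funD[OF w(2), of t] le_funD[OF w(3), of t]
      by (cases "t \<ge> 0") (simp_all add: fa_processes_def)
    then show "w \<le> ?k" by (simp add: le_fun_def[of w])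
  qed
  then show ?thesis
    using ba algebra.orthogonal_in_ba_iff_inf[OF alg]
    by (auto simp: orthogonal_in_def[of "fa_processes A"] modulus_fa_processes[OF alg \<xi>]
        modulus_fa_processes[OF alg \<eta>] fun_eq_iff[of ?k])
qed

section \<open>Variation and total variation norm\<close>

lemma ba_restrict:
  assumes "\<nu> \<in> ba H" "G \<subseteq> H" "algebra \<Omega> G"
  shows "(\<lambda>E. if E \<in> G then \<nu> E else 0) \<in> ba G"
proof -
  interpret algebra \<Omega> G by fact
  have "bounded (\<nu> ` G)"
    using assms by (auto simp: ba_def intro: bounded_subset)
  moreover have "\<nu> (E \<union> F) = \<nu> E + \<nu> F" if "E \<in> G" "F \<in> G" "E \<inter> F = {}" for E F
    using assms that by (intro ba_additive[of \<nu> H]) auto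
  ultimately show ?thesis
    by (auto simp: ba_def additive_def)
qed

lemma variation_le_variation_extension:
  assumes "algebra \<Omega> G" "algebra \<Omega> H" "G \<subseteq> H" "\<mu> \<in> ba G" "\<nu> \<in> ba H"
    and eq: "\<And>E. E \<in> G \<Longrightarrow> \<nu> E = \<mu> E" and E: "E \<in> G"
  shows "variation G \<mu> E \<le> variation H \<nu> E"
proof (rule algebra.variation_le[OF assms(1,4) E])
  fix F K assume FK: "F \<in> G" "K \<in> G" "F \<subseteq> E" "K \<subseteq> E" "F \<inter> K = {}"
  interpret H: algebra \<Omega> H by fact
  have "\<mu> F - \<mu> K \<le> variation H \<nu> F + variation H \<nu> K"
    using eq[OF FK(1)] eq[OF FK(2)] H.abs_le_variation[OF assms(5), of F]
      H.abs_le_variation[OF assms(5), of K] by linarith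
  also have "\<dots> = variation H \<nu> (F \<union> K)"
    using FK \<open>G \<subseteq> H\<close> by (subst ba_additive[OF H.variation_ba[OF assms(5)]]) auto
  also have "\<dots> \<le> variation H \<nu> E"
    using FK \<open>G \<subseteq> H\<close> E
    by (intro H.ba_mono H.variation_ba H.variation_nonneg assms) auto
  finally show "\<mu> F - \<mu> K \<le> variation H \<nu> E" .
qed

context algebra
begin

lemma finite_Union_ba:
  fixes \<mu> :: "'a set \<Rightarrow> real"
  assumes "additive M \<mu>" "finite D" "D \<subseteq> M" "disjoint D"
  shows "\<Union>D \<in> M \<and> \<mu> (\<Union>D) = (\<Sum>E\<in>D. \<mu> E)"
  using assms(2-4)
proof (induction D rule: finite_induct)
  case empty
  then show ?case using assms(1) additiveD[of M \<mu> "{}" "{}"] by simp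
next
  case (insert E D)
  have "E \<inter> \<Union>D = {}"
    using insert.prems(2) insert.hyps(2) by (auto simp: disjoint_def)
  moreover have "\<Union>D \<in> M" "\<mu> (\<Union>D) = (\<Sum>E\<in>D. \<mu> E)"
    using insert.IH insert.prems by (simp_all add: disjoint_def)
  moreover have "E \<in> M" using insert.prems by simp
  ultimately show ?case
    using insert.hyps additiveD[OF assms(1), of E "\<Union>D"] Un[of E "\<Union>D"] by simp
qed

text \<open>Two-element families already approach the supremum, by the Riesz formula.\<close>
lemma tv_norm_eq_variation:
  assumes \<mu>: "\<mu> \<in> ba M"
  shows "tv_norm M \<mu> = variation M \<mu> \<Omega>"
proof (rule antisym)
  let ?S = "{\<Sum>E\<in>D. \<bar>\<mu> E\<bar> | D. finite D \<and> D \<subseteq> M \<and> disjoint D}"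
  have le: "x \<le> variation M \<mu> \<Omega>" if x: "x \<in> ?S" for x
  proof -
    obtain D where D: "finite D" "D \<subseteq> M" "disjoint D" and x: "x = (\<Sum>E\<in>D. \<bar>\<mu> E\<bar>)"
      using x by blast
    have D': "\<Union>D \<in> M" "variation M \<mu> (\<Union>D) = (\<Sum>E\<in>D. variation M \<mu> E)"
      using finite_Union_ba[OF _ D, of "variation M \<mu>"] variation_ba[OF \<mu>] by (auto simp: ba_def)
    have "x \<le> (\<Sum>E\<in>D. variation M \<mu> E)"
      unfolding x by (intro sum_mono abs_le_variation \<mu>)
    also have "\<dots> = variation M \<mu> (\<Union>D)" using D' by simp
    also have "\<dots> \<le> variation M \<mu> \<Omega>"
      using D' sets_into_space by (intro ba_mono variation_ba variation_nonneg \<mu>) auto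
    finally show ?thesis .
  qed
  have "(\<Sum>E\<in>{}. \<bar>\<mu> E\<bar>) \<in> ?S" by fastforce
  then show "tv_norm M \<mu> \<le> variation M \<mu> \<Omega>"
    unfolding tv_norm_def using le by (intro cSup_least) auto
  show "variation M \<mu> \<Omega> \<le> tv_norm M \<mu>"
  proof (rule variation_le[OF \<mu> top])
    fix F K assume FK: "F \<in> M" "K \<in> M" "F \<inter> K = {}"
    have "(\<Sum>E\<in>{F, K}. \<bar>\<mu> E\<bar>) \<in> ?S"
      using FK by (intro CollectI exI[of _ "{F, K}"]) (auto simp: disjoint_def)
    then have "(\<Sum>E\<in>{F, K}. \<bar>\<mu> E\<bar>) \<le> tv_norm M \<mu>"
      unfolding tv_norm_def using le by (intro cSup_upper bdd_aboveI[where M="variation M \<mu> \<Omega>"]) auto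
    then show "\<mu> F - \<mu> K \<le> tv_norm M \<mu>"
      using FK(3) ba_empty[OF \<mu>] by (cases "F = K") auto
  qed
qed

end

section \<open>Extension of positive set functions\<close>

context algebra
begin

lemma finite_partition_splitting:
  assumes "finite S" "S \<subseteq> M"
  obtains D where "finite D" "D \<subseteq> M" "disjoint D" "\<Union>D = \<Omega>"
    "\<And>E d. E \<in> S \<Longrightarrow> d \<in> D \<Longrightarrow> d \<subseteq> E \<or> d \<inter> E = {}"
proof -
  have "\<exists>D. finite D \<and> D \<subseteq> M \<and> disjoint D \<and> \<Union>D = \<Omega> \<and> (\<forall>E\<in>S. \<forall>d\<in>D. d \<subseteq> E \<or> d \<inter> E = {})"
    using assms
  proof (induction S rule: finite_induct)
    case empty
    show ?case by (intro exI[of _ "{\<Omega>}"]) auto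
  next
    case (insert E S)
    then obtain D where D: "finite D" "D \<subseteq> M" "disjoint D" "\<Union>D = \<Omega>"
      "\<forall>E\<in>S. \<forall>d\<in>D. d \<subseteq> E \<or> d \<inter> E = {}" by auto
    let ?D = "(\<lambda>d. d \<inter> E) ` D \<union> (\<lambda>d. d - E) ` D"
    have "disjoint ?D" using D(3) unfolding disjoint_def by blast
    moreover have "?D \<subseteq> M" using D(2) insert.prems by auto
    moreover have "\<Union>?D = \<Omega>" using D(4) by blast
    moreover have "\<forall>E'\<in>insert E S. \<forall>d\<in>?D. d \<subseteq> E' \<or> d \<inter> E' = {}" using D(5) by blast
    ultimately show ?case using D(1) by (intro exI[of _ ?D]) auto
  qed
  then show ?thesis using that by blast
qed

text \<open>
  Extension reduces to finite partitions by Tychonoff's theorem: the additive functions \<open>\<nu>\<close> on \<open>H\<close>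
  with \<open>0 \<le> \<nu> \<le> b\<close> form a compact set, each condition \<open>\<nu> E = \<kappa> E\<close> cuts out a closed
  subset, and finitely many such conditions only involve one finite partition.
\<close>
lemma extension_from_finite_partitions:
  assumes \<kappa>: "\<kappa> \<in> ba M" and H: "algebra \<Omega> H" and sub: "M \<subseteq> H"
    and partition: "\<And>D. finite D \<Longrightarrow> D \<subseteq> M \<Longrightarrow> disjoint D \<Longrightarrow> \<Union>D = \<Omega> \<Longrightarrow>
      \<exists>\<nu>. additive H \<nu> \<and> (\<forall>E\<in>H. 0 \<le> \<nu> E \<and> \<nu> E \<le> b E) \<and> (\<forall>d\<in>D. \<nu> d = \<kappa> d)"
  obtains \<nu> where "\<nu> \<in> ba H" "0 \<le> \<nu>" "\<And>E. E \<in> M \<Longrightarrow> \<nu> E = \<kappa> E" "\<And>E. E \<in> H \<Longrightarrow> \<nu> E \<le> b E"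
proof -
  interpret H: algebra \<Omega> H by fact
  define K :: "('a set \<Rightarrow> real) set"
    where "K = PiE UNIV (\<lambda>E. {0..if E \<in> H then b E else 0}) \<inter> {\<nu>. additive H \<nu>}"
  have "compact (PiE UNIV (\<lambda>E::'a set. {0..if E \<in> H then b E else 0}))"
    using compactin_PiE[of "\<lambda>_. euclidean" UNIV "\<lambda>E::'a set. {0..if E \<in> H then b E else 0}"]
    by (simp add: euclidean_product_topology)
  moreover have "{\<nu>. additive H \<nu>} =
      (\<Inter>x\<in>H. \<Inter>y\<in>{y \<in> H. x \<inter> y = {}}. {\<nu>::'a set \<Rightarrow> real. \<nu> (x \<union> y) = \<nu> x + \<nu> y})"
    by (auto simp: additive_def)
  then have "closed {\<nu>::'a set \<Rightarrow> real. additive H \<nu>}"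
    by (auto intro!: closed_INT closed_Collect_eq continuous_intros)
  ultimately have "compact K" unfolding K_def by (rule compact_Int_closed)
  then have "K \<inter> (\<Inter>E\<in>M. {\<nu>. \<nu> E = \<kappa> E}) \<noteq> {}"
  proof (rule compact_imp_fip_image)
    fix E show "closed {\<nu>::'a set \<Rightarrow> real. \<nu> E = \<kappa> E}"
      by (intro closed_Collect_eq continuous_intros) auto
  next
    fix S assume S: "finite S" "S \<subseteq> M"
    then obtain D where D: "finite D" "D \<subseteq> M" "disjoint D" "\<Union>D = \<Omega>"
      and split: "\<And>E d. E \<in> S \<Longrightarrow> d \<in> D \<Longrightarrow> d \<subseteq> E \<or> d \<inter> E = {}"
      using finite_partition_splitting by metis
    obtain \<nu> where \<nu>: "additive H \<nu>" "\<forall>E\<in>H. 0 \<le> \<nu> E \<and> \<nu> E \<le> b E" "\<forall>d\<in>D. \<nu> d = \<kappa> d"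
      using partition[OF D] by blast
    have "\<nu> E = \<kappa> E" if E: "E \<in> S" for E
    proof -
      let ?D = "{d \<in> D. d \<subseteq> E}"
      have "E = \<Union>?D"
      proof
        show "E \<subseteq> \<Union>?D"
        proof
          fix x assume x: "x \<in> E"
          then have "x \<in> \<Union>D" using E S(2) sets_into_space D(4) by blast
          then obtain d where "d \<in> D" "x \<in> d" by blast
          with split[OF E \<open>d \<in> D\<close>] x show "x \<in> \<Union>?D" by blast
        qed
      qed blast
      moreover have *: "finite ?D" "?D \<subseteq> M" "disjoint ?D" using D by (auto simp: disjoint_def)
      ultimately have "\<nu> E = (\<Sum>d\<in>?D. \<nu> d)" "\<kappa> E = (\<Sum>d\<in>?D. \<kappa> d)"
        using H.finite_Union_ba[OF \<nu>(1), of ?D] sub finite_Union_ba[OF _ *, of \<kappa>] \<kappa>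
        by (auto simp: ba_def)
      then show ?thesis using \<nu>(3) by simp
    qed
    moreover have "(\<lambda>E. if E \<in> H then \<nu> E else 0) \<in> K"
      using \<nu> by (auto simp: K_def additive_def)
    ultimately have "(\<lambda>E. if E \<in> H then \<nu> E else 0) \<in> K \<inter> (\<Inter>E\<in>S. {\<nu>. \<nu> E = \<kappa> E})"
      using S sub by auto
    then show "K \<inter> (\<Inter>E\<in>S. {\<nu>. \<nu> E = \<kappa> E}) \<noteq> {}" by blast
  qed
  then obtain \<nu> where \<nu>: "\<nu> \<in> K" "\<And>E. E \<in> M \<Longrightarrow> \<nu> E = \<kappa> E" by blast
  then have add: "additive H \<nu>" and bd: "0 \<le> \<nu> E" "\<nu> E \<le> (if E \<in> H then b E else 0)" for E
    by (auto simp: K_def PiE_iff)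
  have "\<bar>\<nu> E\<bar> \<le> \<nu> \<Omega>" if E: "E \<in> H" for E
  proof -
    have "E \<union> (\<Omega> - E) = \<Omega>" using E H.sets_into_space by blast
    then have "\<nu> \<Omega> = \<nu> E + \<nu> (\<Omega> - E)" using additiveD[OF add, of E "\<Omega> - E"] E by auto
    then show ?thesis using bd(1)[of E] bd(1)[of "\<Omega> - E"] by simp
  qed
  then have "bounded (\<nu> ` H)" by (auto simp: bounded_iff)
  moreover have "\<nu> E = 0" if "E \<notin> H" for E using bd[of E] that by simp
  ultimately have "\<nu> \<in> ba H" using add by (simp add: ba_def)
  moreover have "0 \<le> \<nu>" using bd(1) by (simp add: le_fun_def)
  moreover have "\<nu> E \<le> b E" if "E \<in> H" for E using bd(2)[of E] that by simp
  ultimately show ?thesis using \<nu>(2) that by blast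
qed

text \<open>On a finite partition, put the mass of each piece at a point of it.\<close>
lemma positive_extension:
  assumes \<kappa>: "\<kappa> \<in> ba M" "0 \<le> \<kappa>" and H: "algebra \<Omega> H" and sub: "M \<subseteq> H"
  obtains \<nu> where "\<nu> \<in> ba H" "0 \<le> \<nu>" "\<And>E. E \<in> M \<Longrightarrow> \<nu> E = \<kappa> E"
proof -
  have pos: "0 \<le> \<kappa> E" for E using \<kappa>(2) by (simp add: le_fun_def)
  show ?thesis
  proof (rule extension_from_finite_partitions[OF \<kappa>(1) H sub, where b="\<lambda>E. \<kappa> \<Omega>"])
    fix D assume D: "finite D" "D \<subseteq> M" "disjoint D" "\<Union>D = \<Omega>"
    let ?\<nu> = "\<lambda>E. \<Sum>d\<in>D. \<kappa> d * indicat_real E (SOME x. x \<in> d)"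
    have "additive H ?\<nu>"
      by (auto simp: additive_def indicator_def sum.distrib[symmetric] intro!: sum.cong)
    moreover have "0 \<le> ?\<nu> E" for E by (intro sum_nonneg mult_nonneg_nonneg pos) auto
    moreover have "?\<nu> E \<le> \<kappa> \<Omega>" for E
    proof -
      have "?\<nu> E \<le> (\<Sum>d\<in>D. \<kappa> d)"
        using pos by (intro sum_mono) (auto simp: indicator_def)
      also have "\<dots> = \<kappa> \<Omega>"
        using finite_Union_ba[OF _ D(1-3), of \<kappa>] D(4) \<kappa>(1) by (auto simp: ba_def)
      finally show ?thesis .
    qed
    moreover have "?\<nu> e = \<kappa> e" if e: "e \<in> D" for e
    proof -
      have "\<kappa> d * indicat_real e (SOME x. x \<in> d) = (if d = e then \<kappa> e else 0)" if d: "d \<in> D" for d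
      proof (cases "d = {}")
        case True
        then show ?thesis using ba_empty[OF \<kappa>(1)] by auto
      next
        case False
        then have "(SOME x. x \<in> d) \<in> d" by (simp add: some_in_eq)
        then have "(SOME x. x \<in> d) \<in> e \<longleftrightarrow> d = e"
          using D(3) d e by (auto simp: disjoint_def)
        then show ?thesis by (auto simp: indicator_def)
      qed
      then show ?thesis using e D(1) by (simp add: sum.delta)
    qed
    ultimately show "\<exists>\<nu>. additive H \<nu> \<and> (\<forall>E\<in>H. 0 \<le> \<nu> E \<and> \<nu> E \<le> \<kappa> \<Omega>) \<and> (\<forall>d\<in>D. \<nu> d = \<kappa> d)"
      by blast
  qed (use that in blast)
qed

text \<open>On a finite partition, spread the mass of each piece proportionally to \<open>m\<close>.\<close>
lemma dominated_extension:
  assumes \<kappa>: "\<kappa> \<in> ba M" "0 \<le> \<kappa>" and H: "algebra \<Omega> H" and sub: "M \<subseteq> H"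
    and m: "m \<in> ba H" "0 \<le> m" and le: "\<And>E. E \<in> M \<Longrightarrow> \<kappa> E \<le> m E"
  obtains \<nu> where "\<nu> \<in> ba H" "0 \<le> \<nu>" "\<nu> \<le> m" "\<And>E. E \<in> M \<Longrightarrow> \<nu> E = \<kappa> E"
proof -
  interpret H: algebra \<Omega> H by fact
  have pos: "0 \<le> \<kappa> E" "0 \<le> m E" for E using \<kappa>(2) m(2) by (simp_all add: le_fun_def)
  show ?thesis
  proof (rule extension_from_finite_partitions[OF \<kappa>(1) H sub, where b=m])
    fix D assume D: "finite D" "D \<subseteq> M" "disjoint D" "\<Union>D = \<Omega>"
    let ?\<nu> = "\<lambda>E. \<Sum>d\<in>D. \<kappa> d / m d * m (E \<inter> d)"
    have "additive H ?\<nu>"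
      unfolding additive_def
    proof (intro ballI impI)
      fix E F assume EF: "E \<in> H" "F \<in> H" "E \<inter> F = {}"
      have "m ((E \<union> F) \<inter> d) = m (E \<inter> d) + m (F \<inter> d)" if "d \<in> D" for d
      proof -
        have "m ((E \<inter> d) \<union> (F \<inter> d)) = m (E \<inter> d) + m (F \<inter> d)"
          using that D(2) sub EF by (intro ba_additive[OF m(1)]) auto
        then show ?thesis by (simp add: Int_Un_distrib2)
      qed
      then show "?\<nu> (E \<union> F) = ?\<nu> E + ?\<nu> F"
        by (simp add: sum.distrib[symmetric] distrib_left)
    qed
    moreover have "0 \<le> ?\<nu> E" for E
      by (intro sum_nonneg mult_nonneg_nonneg divide_nonneg_nonneg pos)
    moreover have "?\<nu> E \<le> m E" if E: "E \<in> H" for E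
    proof -
      have "additive H (\<lambda>F. m (E \<inter> F))"
        unfolding additive_def
        using E ba_additive[OF m(1), of "E \<inter> _" "E \<inter> _"] by (auto simp: Int_Un_distrib)
      then have "(\<Sum>d\<in>D. m (E \<inter> d)) = m (E \<inter> \<Union>D)"
        using H.finite_Union_ba[of "\<lambda>F. m (E \<inter> F)" D] D sub by auto
      moreover have "E \<inter> \<Union>D = E" using D(4) E H.sets_into_space by blast
      moreover have "?\<nu> E \<le> (\<Sum>d\<in>D. m (E \<inter> d))"
      proof (rule sum_mono)
        fix d assume "d \<in> D"
        then have "\<kappa> d / m d \<le> 1"
          using le[of d] D(2) pos(2)[of d] by (auto simp: divide_le_eq_1)
        then show "\<kappa> d / m d * m (E \<inter> d) \<le> m (E \<inter> d)"
          using mult_right_mono[OF _ pos(2)] by fastforce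
      qed
      ultimately show ?thesis by simp
    qed
    moreover have "?\<nu> e = \<kappa> e" if e: "e \<in> D" for e
    proof -
      have "\<kappa> d / m d * m (e \<inter> d) = (if d = e then \<kappa> e else 0)" if d: "d \<in> D" for d
      proof (cases "d = e")
        case True
        have "\<kappa> d = 0" if "m d = 0" using le[of d] pos(1)[of d] D(2) d that by auto
        then show ?thesis using True by auto
      next
        case False
        then have "e \<inter> d = {}" using D(3) d e by (auto simp: disjoint_def)
        then show ?thesis using H.ba_empty[OF m(1)] False by simp
      qed
      then show ?thesis using e D(1) by (simp add: sum.delta)
    qed
    ultimately show "\<exists>\<nu>. additive H \<nu> \<and> (\<forall>E\<in>H. 0 \<le> \<nu> E \<and> \<nu> E \<le> m E) \<and> (\<forall>d\<in>D. \<nu> d = \<kappa> d)"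
      by blast
  next
    fix \<nu> assume \<nu>: "\<nu> \<in> ba H" "0 \<le> \<nu>" "\<And>E. E \<in> M \<Longrightarrow> \<nu> E = \<kappa> E" "\<And>E. E \<in> H \<Longrightarrow> \<nu> E \<le> m E"
    then show thesis using that[of \<nu>] ba_le_iff[OF \<nu>(1) m(1)] by blast
  qed
qed

end

section \<open>Countably additive set functions\<close>

lemma countably_additive_in_ba: "\<mu> \<in> countably_additive_in H \<Longrightarrow> \<mu> \<in> ba H"
  by (simp add: countably_additive_in_def)

lemma countably_additive_in_sums:
  assumes "\<mu> \<in> countably_additive_in H" "range E \<subseteq> H" "disjoint_family E" "(\<Union>i. E i) \<in> H"
  shows "(\<lambda>i. \<mu> (E i)) sums \<mu> (\<Union>i. E i)"
  using assms by (simp add: countably_additive_in_def)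

lemma countably_additive_in_uminus:
  assumes "\<mu> \<in> countably_additive_in H"
  shows "- \<mu> \<in> countably_additive_in H"
  using assms by (auto simp: countably_additive_in_def ba_uminus intro: sums_minus)

lemma countably_additive_in_plus:
  assumes "\<mu> \<in> countably_additive_in H" "\<nu> \<in> countably_additive_in H"
  shows "\<mu> + \<nu> \<in> countably_additive_in H"
  using assms by (auto simp: countably_additive_in_def ba_plus intro: sums_add)

context algebra
begin

lemma sum_ba_disjoint:
  fixes E :: "nat \<Rightarrow> 'a set"
  assumes \<mu>: "\<mu> \<in> ba M" and E: "range E \<subseteq> M" "disjoint_family E"
  shows "(\<Sum>i<n. \<mu> (E i)) = \<mu> (\<Union>i<n. E i)"
proof (induction n)
  case 0
  then show ?case using ba_empty[OF \<mu>] by simp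
next
  case (Suc n)
  have "E i \<inter> E n = {}" if "i < n" for i
    using E(2) that by (simp add: disjoint_family_on_def)
  then have "(\<Union>i<n. E i) \<inter> E n = {}" by blast
  moreover have "(\<Union>i<n. E i) \<in> M" using E(1) by (intro finite_UN) auto
  ultimately have "\<mu> ((\<Union>i<n. E i) \<union> E n) = \<mu> (\<Union>i<n. E i) + \<mu> (E n)"
    using E(1) by (intro ba_additive[OF \<mu>]) auto
  moreover have "(\<Union>i<Suc n. E i) = (\<Union>i<n. E i) \<union> E n"
    by (auto simp: less_Suc_eq)
  ultimately show ?case using Suc.IH by simp
qed

lemma ba_minus_partial_sum:
  fixes E :: "nat \<Rightarrow> 'a set"
  assumes \<mu>: "\<mu> \<in> ba M" and E: "range E \<subseteq> M" "disjoint_family E" "(\<Union>i. E i) \<in> M"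
  shows "\<mu> (\<Union>i. E i) - (\<Sum>i<n. \<mu> (E i)) = \<mu> ((\<Union>i. E i) - (\<Union>i<n. E i))"
proof -
  have "(\<Union>i<n. E i) \<in> M" using E(1) by (intro finite_UN) auto
  moreover have "(\<Union>i<n. E i) \<subseteq> (\<Union>i. E i)" by auto
  ultimately show ?thesis using ba_Diff[OF \<mu> E(3)] sum_ba_disjoint[OF \<mu> E(1,2)] by simp
qed

text \<open>The tails of a disjoint union have small \<open>m\<close>-mass, hence small \<open>\<nu>\<close>-mass.\<close>
lemma dominated_countably_additive_in:
  assumes \<nu>: "\<nu> \<in> ba M" "0 \<le> \<nu>" and le: "\<nu> \<le> m" and m: "m \<in> countably_additive_in M"
  shows "\<nu> \<in> countably_additive_in M"
proof -
  have "(\<lambda>i. \<nu> (E i)) sums \<nu> (\<Union>i. E i)"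
    if E: "range E \<subseteq> M" "disjoint_family E" "(\<Union>i. E i) \<in> M" for E :: "nat \<Rightarrow> 'a set"
  proof -
    have "(\<lambda>n. \<Sum>i<n. m (E i)) \<longlonglongrightarrow> m (\<Union>i. E i)"
      using countably_additive_in_sums[OF m E] by (simp add: sums_def)
    from tendsto_diff[OF tendsto_const this, of "m (\<Union>i. E i)"]
    have lim: "(\<lambda>n. m (\<Union>i. E i) - (\<Sum>i<n. m (E i))) \<longlonglongrightarrow> 0" by simp
    have bds: "0 \<le> \<nu> (\<Union>i. E i) - (\<Sum>i<n. \<nu> (E i))"
      "\<nu> (\<Union>i. E i) - (\<Sum>i<n. \<nu> (E i)) \<le> m (\<Union>i. E i) - (\<Sum>i<n. m (E i))" for n
      unfolding ba_minus_partial_sum[OF \<nu>(1) E] ba_minus_partial_sum[OF countably_additive_in_ba[OF m] E]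
      using le_funD[OF \<nu>(2)] le_funD[OF le] by simp_all
    have "(\<lambda>n. \<nu> (\<Union>i. E i) - (\<Sum>i<n. \<nu> (E i))) \<longlonglongrightarrow> 0"
      by (rule tendsto_sandwich[OF always_eventually always_eventually tendsto_const lim])
        (intro allI bds)+
    then have "(\<lambda>n. \<nu> (\<Union>i. E i) - (\<nu> (\<Union>i. E i) - (\<Sum>i<n. \<nu> (E i)))) \<longlonglongrightarrow> \<nu> (\<Union>i. E i) - 0"
      by (intro tendsto_intros)
    then show ?thesis by (simp add: sums_def)
  qed
  then show ?thesis using \<nu>(1) by (simp add: countably_additive_in_def)
qed

text \<open>
  Finite additivity and positivity bound the partial sums by the value at the union; the converse
  inequality only needs to be checked on each competitor \<open>F\<close> in the Riesz formula, where it is the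
  countable additivity of \<open>\<mu>\<close>.
\<close>
lemma pos_var_countably_additive_in:
  assumes \<mu>: "\<mu> \<in> countably_additive_in M"
  shows "pos_var M \<mu> \<in> countably_additive_in M"
proof -
  note ba = countably_additive_in_ba[OF \<mu>]
  note pba = pos_var_ba[OF ba] and pos = pos_var_nonneg[OF ba]
  have "(\<lambda>i. pos_var M \<mu> (E i)) sums pos_var M \<mu> (\<Union>i. E i)"
    if E: "range E \<subseteq> M" "disjoint_family E" "(\<Union>i. E i) \<in> M" for E :: "nat \<Rightarrow> 'a set"
  proof -
    have le: "(\<Sum>i<n. pos_var M \<mu> (E i)) \<le> pos_var M \<mu> (\<Union>i. E i)" for n
      using ba_minus_partial_sum[OF pba E, of n]
        le_funD[OF pos, of "(\<Union>i. E i) - (\<Union>i<n. E i)"] by simp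
    have nn: "0 \<le> pos_var M \<mu> F" for F using pos by (simp add: le_fun_def)
    have sm: "summable (\<lambda>i. pos_var M \<mu> (E i))"
      by (rule summableI_nonneg_bounded[OF nn le])
    have "pos_var M \<mu> (\<Union>i. E i) \<le> (\<Sum>i. pos_var M \<mu> (E i))"
    proof (rule pos_var_least[OF E(3)])
      fix F assume F: "F \<in> M" "F \<subseteq> (\<Union>i. E i)"
      have FE: "range (\<lambda>i. F \<inter> E i) \<subseteq> M" using F(1) E(1) by auto
      moreover have "disjoint_family (\<lambda>i. F \<inter> E i)"
        using E(2) by (auto simp: disjoint_family_on_def)
      moreover have eq: "(\<Union>i. F \<inter> E i) = F" using F(2) by blast
      ultimately have sumF: "(\<lambda>i. \<mu> (F \<inter> E i)) sums \<mu> F"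
        using countably_additive_in_sums[OF \<mu>, of "\<lambda>i. F \<inter> E i"] F(1) by simp
      have "\<mu> (F \<inter> E i) \<le> pos_var M \<mu> (E i)" for i
        using E(1) FE by (intro pos_var_upper[OF ba]) auto
      then show "\<mu> F \<le> (\<Sum>i. pos_var M \<mu> (E i))"
        by (rule sums_le[OF _ sumF summable_sums[OF sm]])
    qed
    moreover have "(\<Sum>i. pos_var M \<mu> (E i)) \<le> pos_var M \<mu> (\<Union>i. E i)"
      using sm le by (intro suminf_le_const) auto
    ultimately have "(\<Sum>i. pos_var M \<mu> (E i)) = pos_var M \<mu> (\<Union>i. E i)" by simp
    then show ?thesis using summable_sums[OF sm] by metis
  qed
  then show ?thesis using pba by (simp add: countably_additive_in_def)
qed

lemma variation_countably_additive_in: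
  "\<mu> \<in> countably_additive_in M \<Longrightarrow> variation M \<mu> \<in> countably_additive_in M"
  unfolding variation_def
  by (intro countably_additive_in_plus pos_var_countably_additive_in countably_additive_in_uminus)

end

section \<open>Orthogonality of the two classes\<close>

lemma ca_ba: "\<mu> \<in> ca G H \<Longrightarrow> \<mu> \<in> ba G"
  by (simp add: ca_def)

lemma pfa_ba: "\<mu> \<in> pfa G H \<Longrightarrow> \<mu> \<in> ba G"
  by (simp add: pfa_def)

lemma pfa_uminus:
  assumes "algebra \<Omega> G" "algebra \<Omega> H" "\<mu> \<in> pfa G H"
  shows "- \<mu> \<in> pfa G H"
proof -
  interpret G: algebra \<Omega> G by fact
  interpret H: algebra \<Omega> H by fact
  note ba = pfa_ba[OF assms(3)]
  have "\<nu> \<in> purely_fin_additive_in H"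
    if \<nu>: "\<nu> \<in> ba H" "\<forall>E\<in>G. \<nu> E = (- \<mu>) E" "tv_norm H \<nu> = tv_norm G (- \<mu>)" for \<nu>
  proof -
    have "tv_norm H (- \<nu>) = tv_norm G \<mu>"
      using \<nu>(3) by (simp add: H.tv_norm_eq_variation G.tv_norm_eq_variation \<nu>(1) ba ba_uminus)
    moreover have "\<forall>E\<in>G. (- \<nu>) E = \<mu> E" using \<nu>(2) by simp
    ultimately have "- \<nu> \<in> purely_fin_additive_in H"
      using assms(3) ba_uminus[OF \<nu>(1)] by (simp add: pfa_def)
    then show ?thesis
      using \<nu>(1) H.orthogonal_in_ba_uminus[OF \<nu>(1) countably_additive_in_ba]
      by (simp add: purely_fin_additive_in_def)
  qed
  then show ?thesis by (simp add: pfa_def ba_uminus[OF ba])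
qed

text \<open>
  Let \<open>\<kappa>\<close> be the meet of \<open>\<pi>\<^sup>+\<close> with the countably additive \<open>m\<close>. Extend \<open>\<kappa>\<close>, \<open>\<pi>\<^sup>+ - \<kappa>\<close> and \<open>\<pi>\<^sup>-\<close>
  separately to positive set functions on \<open>H\<close>, the first below \<open>m\<close> and hence countably additive.
  The first two minus the third give a norm-preserving extension of \<open>\<pi>\<close>, because
  \<open>\<pi>\<^sup>+ \<Omega> + \<pi>\<^sup>- \<Omega>\<close> is the norm of \<open>\<pi>\<close>. By assumption it is orthogonal to the extension of \<open>\<kappa>\<close>.
  But that extension is one of its summands and is not cancelled by the subtracted one, since a
  member of \<open>G\<close> almost separates \<open>\<pi>\<^sup>+\<close> from \<open>\<pi>\<^sup>-\<close>; so \<open>\<kappa> = 0\<close>.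
\<close>
lemma pfa_pos_var_orthogonal:
  assumes G: "algebra \<Omega> G" and H: "algebra \<Omega> H" and sub: "G \<subseteq> H"
    and \<pi>: "\<pi> \<in> pfa G H" and m: "m \<in> countably_additive_in H" "0 \<le> m"
  shows "orthogonal_in (ba G) (pos_var G \<pi>) (\<lambda>E. if E \<in> G then m E else 0)"
proof -
  interpret G: algebra \<Omega> G by fact
  interpret H: algebra \<Omega> H by fact
  note ba = pfa_ba[OF \<pi>]
  note mba = countably_additive_in_ba[OF m(1)]
  define m' where "m' = (\<lambda>E. if E \<in> G then m E else 0)"
  define p where "p = pos_var G \<pi>"
  define r where "r = p - \<pi>"
  define \<kappa> where "\<kappa> = ba_inf G p m'"
  define q where "q = p - \<kappa>"
  have m': "m' \<in> ba G" "0 \<le> m'"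
    unfolding m'_def using ba_restrict[OF mba sub G] m(2) by (auto simp: le_fun_def)
  have p: "p \<in> ba G" "0 \<le> p"
    unfolding p_def by (intro G.pos_var_ba ba) (rule G.pos_var_nonneg[OF ba])
  have r_eq: "r = pos_var G (- \<pi>)" unfolding r_def p_def by (rule G.pos_var_uminus[OF ba, symmetric])
  have r: "r \<in> ba G" "0 \<le> r"
    unfolding r_eq by (intro G.pos_var_ba ba_uminus ba) (rule G.pos_var_nonneg[OF ba_uminus[OF ba]])
  have \<kappa>: "\<kappa> \<in> ba G" "0 \<le> \<kappa>" "\<kappa> \<le> p" "\<kappa> \<le> m'"
    unfolding \<kappa>_def using G.ba_inf_ba[OF p(1) m'(1)] G.ba_inf_le[OF p(1) m'(1)]
      G.ba_inf_greatest[OF p(1) m'(1) ba_0 p(2) m'(2)] by auto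
  have q: "q \<in> ba G" "0 \<le> q"
    unfolding q_def using ba_minus[OF p(1) \<kappa>(1)] \<kappa>(3) by (auto simp: le_fun_def)
  have "\<kappa> E \<le> m E" if "E \<in> G" for E
    using le_funD[OF \<kappa>(4), of E] that by (simp add: m'_def)
  then obtain k where k: "k \<in> ba H" "0 \<le> k" "k \<le> m" "\<And>E. E \<in> G \<Longrightarrow> k E = \<kappa> E"
    using G.dominated_extension[OF \<kappa>(1,2) H sub mba m(2)] by metis
  obtain s where s: "s \<in> ba H" "0 \<le> s" "\<And>E. E \<in> G \<Longrightarrow> s E = q E"
    using G.positive_extension[OF q H sub] by metis
  obtain u where u: "u \<in> ba H" "0 \<le> u" "\<And>E. E \<in> G \<Longrightarrow> u E = r E"
    using G.positive_extension[OF r H sub] by metis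
  define \<nu> where "\<nu> = k + s - u"
  have nn: "0 \<le> k E" "0 \<le> s E" "0 \<le> u E" for E
    using k(2) s(2) u(2) by (simp_all add: le_fun_def)
  have \<nu>: "\<nu> \<in> ba H" unfolding \<nu>_def by (intro ba_minus ba_plus k s u)
  have ext: "\<nu> E = \<pi> E" if "E \<in> G" for E
    using that by (simp add: \<nu>_def k(4) s(3) u(3) q_def r_def)
  have "variation H \<nu> \<Omega> = variation G \<pi> \<Omega>"
  proof (rule antisym)
    have "\<nu> \<le> k + s + u" "- \<nu> \<le> k + s + u"
      unfolding le_fun_def \<nu>_def using nn by (auto intro: add_nonneg_nonneg)
    then have "variation H \<nu> \<le> k + s + u"
      by (intro H.variation_least \<nu> ba_plus k s u)
    then have "variation H \<nu> \<Omega> \<le> k \<Omega> + s \<Omega> + u \<Omega>"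
      by (auto simp: le_fun_def)
    also have "\<dots> = variation G \<pi> \<Omega>"
      by (simp add: k(4) s(3) u(3) q_def variation_def p_def r_eq)
    finally show "variation H \<nu> \<Omega> \<le> variation G \<pi> \<Omega>" .
    show "variation G \<pi> \<Omega> \<le> variation H \<nu> \<Omega>"
      by (intro variation_le_variation_extension[OF G H sub ba \<nu> ext]) auto
  qed
  then have "\<nu> \<in> purely_fin_additive_in H"
    using \<pi> \<nu> ext by (simp add: pfa_def H.tv_norm_eq_variation G.tv_norm_eq_variation)
  moreover have "k \<in> countably_additive_in H"
    by (intro H.dominated_countably_additive_in[OF k(1-3) m(1)])
  ultimately have orth: "orthogonal_in (ba H) \<nu> k" by (simp add: purely_fin_additive_in_def)
  have "\<kappa> \<Omega> \<le> 0"
  proof (rule field_le_epsilon)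
    fix \<epsilon> :: real assume "\<epsilon> > 0"
    then have e: "\<epsilon> / 3 > 0" by simp
    obtain F where F: "F \<in> H" "variation H \<nu> F + k (\<Omega> - F) < \<epsilon> / 3"
      using orth[unfolded H.orthogonal_in_ba_iff[OF \<nu> k(1)], rule_format, OF e]
        H.variation_of_nonneg[OF k(1,2)] by auto
    \<comment> \<open>Off \<open>C\<close> there is almost no \<open>\<pi>\<^sup>+\<close>, hence almost no \<open>\<kappa>\<close>; on \<open>C\<close> there is almost no \<open>\<pi>\<^sup>-\<close>.\<close>
    obtain C where C: "C \<in> G" "p \<Omega> - \<epsilon> / 3 < \<pi> C"
      using pos_var_approx[OF G.top e, of \<pi>] unfolding p_def by metis
    have CH: "C \<in> H" using C sub by auto
    have C\<Omega>: "p (\<Omega> - C) = p \<Omega> - p C"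
      using C G.sets_into_space by (intro G.ba_Diff p) auto
    have "\<pi> C \<le> p C" unfolding p_def using C by (intro pos_var_upper[OF ba]) auto
    then have pC: "p (\<Omega> - C) < \<epsilon> / 3" using C(2) C\<Omega> by simp
    have "p C \<le> p \<Omega>" using C G.sets_into_space by (intro G.ba_mono p) auto
    then have "r C < \<epsilon> / 3" using C(2) by (simp add: r_def)
    have "k (F - C) \<le> k (\<Omega> - C)"
      using F C CH H.sets_into_space by (intro H.ba_mono k) auto
    also have "\<dots> \<le> p (\<Omega> - C)" using k(4)[OF G.compl_sets[OF C(1)]] le_funD[OF \<kappa>(3)] by simp
    finally have 1: "k (F - C) < \<epsilon> / 3" using pC by simp
    have "k (F \<inter> C) \<le> \<nu> (F \<inter> C) + u (F \<inter> C)" using nn(2) by (simp add: \<nu>_def)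
    also have "\<dots> \<le> variation H \<nu> F + u C"
    proof (rule add_mono)
      have "\<nu> (F \<inter> C) \<le> variation H \<nu> (F \<inter> C)" using H.le_variation[OF \<nu>] by (simp add: le_fun_def)
      also have "\<dots> \<le> variation H \<nu> F"
        using F CH by (intro H.ba_mono H.variation_ba H.variation_nonneg \<nu>) auto
      finally show "\<nu> (F \<inter> C) \<le> variation H \<nu> F" .
      show "u (F \<inter> C) \<le> u C" using F CH by (intro H.ba_mono u) auto
    qed
    also have "\<dots> < variation H \<nu> F + \<epsilon> / 3" using \<open>r C < \<epsilon> / 3\<close> u(3)[OF C(1)] by simp
    finally have 2: "k (F \<inter> C) < variation H \<nu> F + \<epsilon> / 3" .
    have "\<kappa> \<Omega> = k F + k (\<Omega> - F)"
      using k(4)[of \<Omega>] H.ba_Diff[OF k(1) H.top F(1)] F(1) H.sets_into_space by auto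
    also have "k F = k (F \<inter> C) + k (F - C)" by (rule H.ba_split[OF k(1) F(1) CH])
    finally show "\<kappa> \<Omega> \<le> 0 + \<epsilon>" using 1 2 F(2) by simp
  qed
  then have "\<kappa> E = 0" for E
    using G.ba_mono[OF \<kappa>(1,2) G.top, of E] \<kappa>(2) ba_outside[OF \<kappa>(1), of E] G.sets_into_space[of E]
    by (cases "E \<in> G") (auto simp: le_fun_def intro: antisym order_trans)
  then have "\<kappa> = 0" by (simp add: fun_eq_iff)
  then show ?thesis
    using G.orthogonal_in_ba_iff_inf[OF p(1) m'(1)] G.variation_of_nonneg[OF p]
      G.variation_of_nonneg[OF m'] by (simp add: \<kappa>_def p_def m'_def)
qed

text \<open>
  The variation of \<open>\<mu>\<close> lies below the restriction of the variation of its countably additive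
  extension, to which both \<open>\<pi>\<^sup>+\<close> and \<open>\<pi>\<^sup>- = (- \<pi>)\<^sup>+\<close> are orthogonal.
\<close>
lemma pfa_orthogonal_ca:
  assumes G: "algebra \<Omega> G" and H: "algebra \<Omega> H" and sub: "G \<subseteq> H"
    and \<pi>: "\<pi> \<in> pfa G H" and \<mu>: "\<mu> \<in> ca G H"
  shows "orthogonal_in (ba G) \<pi> \<mu>"
proof -
  interpret G: algebra \<Omega> G by fact
  interpret H: algebra \<Omega> H by fact
  note ba = pfa_ba[OF \<pi>] ca_ba[OF \<mu>]
  obtain \<nu> where \<nu>: "\<nu> \<in> countably_additive_in H" "\<And>E. E \<in> G \<Longrightarrow> \<nu> E = \<mu> E"
    using \<mu> by (auto simp: ca_def)
  define m where "m = variation H \<nu>"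
  define m' where "m' = (\<lambda>E. if E \<in> G then m E else 0)"
  have m: "m \<in> countably_additive_in H" "0 \<le> m"
    unfolding m_def using H.variation_countably_additive_in[OF \<nu>(1)]
      H.variation_nonneg[OF countably_additive_in_ba[OF \<nu>(1)]] by auto
  have m': "m' \<in> ba G" "0 \<le> m'"
    unfolding m'_def using ba_restrict[OF countably_additive_in_ba[OF m(1)] sub G] m(2)
    by (auto simp: le_fun_def)
  have \<mu>m: "variation G \<mu> E \<le> m' E" if "E \<in> G" for E
    using variation_le_variation_extension[OF G H sub ba(2) countably_additive_in_ba[OF \<nu>(1)] \<nu>(2) that] that
    by (simp add: m'_def m_def)
  show ?thesis
    unfolding G.orthogonal_in_ba_iff[OF ba]
  proof (intro allI impI)
    fix \<epsilon> :: real assume "\<epsilon> > 0"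
    then have e: "\<epsilon> / 2 > 0" by simp
    have *: "\<exists>F\<in>G. pos_var G \<sigma> F + m' (\<Omega> - F) < \<epsilon> / 2" if \<sigma>: "\<sigma> \<in> pfa G H" for \<sigma>
    proof -
      have "pos_var G \<sigma> \<in> ba G" "0 \<le> pos_var G \<sigma>"
        using G.pos_var_ba G.pos_var_nonneg pfa_ba[OF \<sigma>] by auto
      then show ?thesis
        using pfa_pos_var_orthogonal[OF G H sub \<sigma> m, folded m'_def] e
          G.orthogonal_in_ba_iff[of "pos_var G \<sigma>" m'] m' G.variation_of_nonneg by metis
    qed
    obtain F1 where F1: "F1 \<in> G" "pos_var G \<pi> F1 + m' (\<Omega> - F1) < \<epsilon> / 2"
      using *[OF \<pi>] by blast
    obtain F2 where F2: "F2 \<in> G" "pos_var G (- \<pi>) F2 + m' (\<Omega> - F2) < \<epsilon> / 2"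
      using *[OF pfa_uminus[OF G H \<pi>]] by blast
    let ?F = "F1 \<inter> F2"
    have "pos_var G \<pi> ?F \<le> pos_var G \<pi> F1"
      using F1 F2 by (intro G.ba_mono G.pos_var_ba G.pos_var_nonneg ba) auto
    moreover have "pos_var G (- \<pi>) ?F \<le> pos_var G (- \<pi>) F2"
      using F1 F2 by (intro G.ba_mono G.pos_var_ba G.pos_var_nonneg ba_uminus ba) auto
    moreover have "m' (\<Omega> - ?F) \<le> m' (\<Omega> - F1) + m' (\<Omega> - F2)"
    proof -
      have "\<Omega> - ?F = (\<Omega> - F1) \<union> (F1 - F2)" using F1(1) G.sets_into_space by blast
      then have "m' (\<Omega> - ?F) = m' (\<Omega> - F1) + m' (F1 - F2)"
        using F1 F2 by (simp only:) (intro ba_additive[OF m'(1)], auto)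
      moreover have "m' (F1 - F2) \<le> m' (\<Omega> - F2)"
        using F1 F2 G.sets_into_space by (intro G.ba_mono m') auto
      ultimately show ?thesis by simp
    qed
    moreover have "variation G \<mu> (\<Omega> - ?F) \<le> m' (\<Omega> - ?F)"
      using F1 F2 by (intro \<mu>m) auto
    ultimately have "variation G \<pi> ?F + variation G \<mu> (\<Omega> - ?F) < \<epsilon>"
      using F1(2) F2(2) by (simp add: variation_def)
    then show "\<exists>F\<in>G. variation G \<pi> F + variation G \<mu> (\<Omega> - F) < \<epsilon>"
      using F1(1) F2(1) by blast
  qed
qed

section \<open>Measures from countably additive set functions\<close>

lemma measure_of_countably_additive_in:
  assumes H: "sigma_algebra \<Omega> H" and m: "m \<in> countably_additive_in H" "0 \<le> m"
  obtains N where "finite_measure N" "space N = \<Omega>" "sets N = H"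
    "\<And>E. E \<in> H \<Longrightarrow> emeasure N E = ennreal (m E)" "\<And>E. E \<in> H \<Longrightarrow> measure N E = m E"
proof -
  interpret sigma_algebra \<Omega> H by fact
  have nn: "0 \<le> m E" for E using m(2) by (simp add: le_fun_def)
  define N where "N = measure_of \<Omega> H (\<lambda>E. ennreal (m E))"
  have em: "emeasure N E = ennreal (m E)" if E: "E \<in> H" for E
    unfolding N_def
  proof (rule emeasure_measure_of_sigma[OF H])
    show "positive H (\<lambda>E. ennreal (m E))"
      using ba_empty[OF countably_additive_in_ba[OF m(1)]] by (simp add: positive_def)
    show "countably_additive H (\<lambda>E. ennreal (m E))"
    proof (rule countably_additiveI)
      fix E :: "nat \<Rightarrow> 'a set"
      assume E: "range E \<subseteq> H" "disjoint_family E" "(\<Union>i. E i) \<in> H"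
      show "(\<Sum>i. ennreal (m (E i))) = ennreal (m (\<Union>i. E i))"
        by (intro suminf_ennreal_eq nn countably_additive_in_sums[OF m(1) E])
    qed
  qed (rule E)
  have sp: "space N = \<Omega>" and st: "sets N = H"
    unfolding N_def using space_closed by (simp_all add: sets_measure_of_eq)
  have "finite_measure N"
    using em[OF top] sp by (intro finite_measureI) simp
  moreover have "measure N E = m E" if "E \<in> H" for E
    using em[OF that] nn by (simp add: measure_def)
  ultimately show ?thesis using that sp st em by blast
qed

lemma countably_additive_in_restrict:
  assumes "\<nu> \<in> countably_additive_in H" "S \<subseteq> H" "algebra \<Omega> S"
  shows "(\<lambda>E. if E \<in> S then \<nu> E else 0) \<in> countably_additive_in S"
proof -
  have "(\<lambda>i. if E i \<in> S then \<nu> (E i) else 0) sums \<nu> (\<Union>i. E i)"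
    if E: "range E \<subseteq> S" "disjoint_family E" "(\<Union>i. E i) \<in> S" for E :: "nat \<Rightarrow> 'a set"
  proof -
    have "E i \<in> S" for i using E(1) by auto
    moreover have "(\<lambda>i. \<nu> (E i)) sums \<nu> (\<Union>i. E i)"
      using E assms(2) by (intro countably_additive_in_sums[OF assms(1)]) auto
    ultimately show ?thesis by simp
  qed
  then show ?thesis
    using ba_restrict[OF countably_additive_in_ba[OF assms(1)] assms(2,3)]
    by (simp add: countably_additive_in_def)
qed

text \<open>
  The sets that can be approximated form a \<open>\<sigma>\<close>-algebra: for a countable union, cut off the tail
  and approximate the finitely many remaining sets.
\<close>
lemma sigma_sets_approximation:
  assumes G: "algebra \<Omega> G" and N: "finite_measure N" "space N = \<Omega>" "G \<subseteq> sets N"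
    and E: "E \<in> sigma_sets \<Omega> G" and "\<epsilon> > 0"
  shows "\<exists>B\<in>G. measure N (sym_diff E B) < \<epsilon>"
  using E \<open>\<epsilon> > 0\<close>
proof (induction E arbitrary: \<epsilon> rule: sigma_sets.induct)
  case (Basic a)
  then show ?case by (intro bexI[of _ a]) auto
next
  case Empty
  interpret algebra \<Omega> G by fact
  show ?case using Empty by (intro bexI[of _ "{}"]) auto
next
  case (Compl a)
  interpret algebra \<Omega> G by fact
  obtain B where B: "B \<in> G" "measure N (sym_diff a B) < \<epsilon>" using Compl by blast
  have "a \<subseteq> \<Omega>" using Compl(1) sigma_sets_into_sp[OF space_closed] by blast
  then have "sym_diff (\<Omega> - a) (\<Omega> - B) = sym_diff a B"
    using sets_into_space[OF B(1)] by blast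
  then show ?case using B by (intro bexI[of _ "\<Omega> - B"]) auto
next
  case (Union a)
  interpret algebra \<Omega> G by fact
  interpret N: finite_measure N by fact
  have aN: "a i \<in> sets N" for i
    using Union(1)[of i] sets.sigma_sets_subset[OF N(3)] N(2) by auto
  have "(\<lambda>n. measure N (\<Union>i<n. a i)) \<longlonglongrightarrow> measure N (\<Union>n. \<Union>i<n. a i)"
    using aN by (intro N.finite_Lim_measure_incseq incseq_SucI) (auto intro: less_SucI)
  moreover have "(\<Union>n. \<Union>i<n. a i) = (\<Union>i. a i)" by blast
  moreover have "\<epsilon> / 2 > 0" using \<open>\<epsilon> > 0\<close> by simp
  ultimately have "\<forall>\<^sub>F n in sequentially. measure N (\<Union>i. a i) - \<epsilon> / 2 < measure N (\<Union>i<n. a i)"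
    by (intro order_tendstoD) auto
  then obtain n where n: "measure N (\<Union>i. a i) - \<epsilon> / 2 < measure N (\<Union>i<n. a i)"
    by (auto simp: eventually_sequentially)
  have "measure N ((\<Union>i. a i) - (\<Union>i<n. a i)) = measure N (\<Union>i. a i) - measure N (\<Union>i<n. a i)"
    using aN by (intro N.finite_measure_Diff) auto
  then have tail: "measure N ((\<Union>i. a i) - (\<Union>i<n. a i)) < \<epsilon> / 2" using n by simp
  define \<delta> where "\<delta> = \<epsilon> / 2 / real (Suc n)"
  have "\<delta> > 0" using \<open>\<epsilon> > 0\<close> by (simp add: \<delta>_def)
  then have "\<forall>i. \<exists>B\<in>G. measure N (sym_diff (a i) B) < \<delta>" using Union.IH by blast
  then obtain B where B: "\<And>i. B i \<in> G" "\<And>i. measure N (sym_diff (a i) (B i)) < \<delta>" by metis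
  have BN: "B i \<in> sets N" for i using B(1) N(3) by blast
  let ?B = "\<Union>i<n. B i" and ?d = "\<Union>i<n. sym_diff (a i) (B i)"
  have "sym_diff (\<Union>i. a i) ?B \<subseteq> ((\<Union>i. a i) - (\<Union>i<n. a i)) \<union> ?d" by blast
  then have "measure N (sym_diff (\<Union>i. a i) ?B)
      \<le> measure N (((\<Union>i. a i) - (\<Union>i<n. a i)) \<union> ?d)"
    using aN BN by (intro N.finite_measure_mono) auto
  also have "\<dots> \<le> measure N ((\<Union>i. a i) - (\<Union>i<n. a i)) + measure N ?d"
    using aN BN by (intro measure_Un_le) auto
  also have "measure N ?d \<le> (\<Sum>i<n. measure N (sym_diff (a i) (B i)))"
    using aN BN by (intro measure_UNION_le) auto
  also have "\<dots> \<le> (\<Sum>i<n. \<delta>)" using B(2) by (intro sum_mono less_imp_le)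
  also have "\<dots> \<le> \<epsilon> / 2" using \<open>\<epsilon> > 0\<close> by (simp add: \<delta>_def field_simps)
  finally have "measure N (sym_diff (\<Union>i. a i) ?B) < \<epsilon>" using tail by simp
  moreover have "?B \<in> G" using B(1) by (intro finite_UN) auto
  ultimately show ?case by blast
qed

text \<open>
  Approximate a member of the generated \<open>\<sigma>\<close>-algebra by members of the algebra with respect to the
  variation of \<open>\<nu>\<close>.
\<close>
lemma nonneg_on_sigma_sets:
  assumes H: "sigma_algebra \<Omega> H" and G: "algebra \<Omega> G" "G \<subseteq> H"
    and \<nu>: "\<nu> \<in> countably_additive_in H" and pos: "\<And>E. E \<in> G \<Longrightarrow> 0 \<le> \<nu> E"
    and E: "E \<in> sigma_sets \<Omega> G"
  shows "0 \<le> \<nu> E"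
proof (rule field_le_epsilon)
  fix \<epsilon> :: real assume "\<epsilon> > 0"
  interpret H: sigma_algebra \<Omega> H by fact
  note ba = countably_additive_in_ba[OF \<nu>]
  obtain N where N: "finite_measure N" "space N = \<Omega>" "sets N = H"
    "\<And>E. E \<in> H \<Longrightarrow> measure N E = variation H \<nu> E"
    using measure_of_countably_additive_in[OF H H.variation_countably_additive_in[OF \<nu>]
        H.variation_nonneg[OF ba]] by metis
  obtain B where B: "B \<in> G" "measure N (sym_diff E B) < \<epsilon>"
    using sigma_sets_approximation[OF G(1) N(1,2) _ E \<open>\<epsilon> > 0\<close>] G(2) N(3) by blast
  have EH: "E \<in> H" "B \<in> H" using E G(2) B(1) H.sigma_sets_subset by auto
  have "variation H \<nu> (E - B) + variation H \<nu> (B - E) = variation H \<nu> (sym_diff E B)"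
    using EH by (intro ba_additive[OF H.variation_ba[OF ba], symmetric]) auto
  also have "\<dots> < \<epsilon>" using B(2) N(4)[OF H.Un[OF H.Diff[OF EH] H.Diff[OF EH(2,1)]]] by simp
  finally have "variation H \<nu> (E - B) + variation H \<nu> (B - E) < \<epsilon>" .
  moreover have "\<nu> E = \<nu> B + \<nu> (E - B) - \<nu> (B - E)"
    using H.ba_split[OF ba EH] H.ba_split[OF ba EH(2,1)] by (simp add: Int_commute)
  ultimately show "0 \<le> \<nu> E + \<epsilon>"
    using pos[OF B(1)] H.abs_le_variation[OF ba, of "E - B"] H.abs_le_variation[OF ba, of "B - E"]
    by linarith
qed

lemma prob_measure_dominating_one:
  assumes H: "sigma_algebra \<Omega> H" and "\<Omega> \<noteq> {}" and \<nu>: "\<nu> \<in> countably_additive_in H"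
  shows "\<exists>Q. prob_space Q \<and> sets Q = H \<and> (\<forall>E\<in>null_sets Q. \<nu> E = 0)"
proof -
  interpret H: sigma_algebra \<Omega> H by fact
  note ba = countably_additive_in_ba[OF \<nu>]
  obtain N where N: "finite_measure N" "space N = \<Omega>" "sets N = H"
    "\<And>E. E \<in> H \<Longrightarrow> emeasure N E = ennreal (variation H \<nu> E)"
    using measure_of_countably_additive_in[OF H H.variation_countably_additive_in[OF \<nu>]
        H.variation_nonneg[OF ba]] by metis
  interpret N: finite_measure N by fact
  have zero: "\<nu> E = 0" if "E \<in> H" "emeasure N E = 0" for E
    using that N(4)[OF that(1)] H.abs_le_variation[OF ba, of E] by (simp add: ennreal_eq_0_iff)
  show ?thesis
  proof (cases "emeasure N \<Omega> = 0")
    case True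
    obtain x where "x \<in> \<Omega>" using \<open>\<Omega> \<noteq> {}\<close> by blast
    then have "prob_space (return N x)" using N(2) by (intro prob_space_return) simp
    moreover have "\<nu> E = 0" if "E \<in> H" for E
    proof -
      have "emeasure N E \<le> emeasure N \<Omega>"
        using that H.sets_into_space N(3) by (intro emeasure_mono) auto
      then show ?thesis using zero[OF that] True by simp
    qed
    ultimately show ?thesis
      using N(3) by (intro exI[of _ "return N x"]) (auto dest: null_setsD2)
  next
    case False
    let ?Q = "uniform_measure N \<Omega>"
    have "prob_space ?Q" using False by (intro prob_space_uniform_measure) auto
    moreover have "sets ?Q = H" using N(3) by simp
    moreover have "\<nu> E = 0" if E: "E \<in> null_sets ?Q" for E
    proof -
      have EH: "E \<in> H" using E N(3) by auto
      have "emeasure N (\<Omega> \<inter> E) / emeasure N \<Omega> = 0"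
        using emeasure_uniform_measure[of \<Omega> N E] EH N(3) null_setsD1[OF E] by simp
      then have "emeasure N (\<Omega> \<inter> E) = 0" by (simp add: ennreal_divide_eq_0_iff)
      moreover have "\<Omega> \<inter> E = E" using H.sets_into_space[OF EH] by blast
      ultimately show ?thesis using zero[OF EH] by simp
    qed
    ultimately show ?thesis by blast
  qed
qed

text \<open>
  Mix probabilities that dominate the members one by one with the weights of a geometric
  distribution; all that matters about the weights is that none of them vanishes.
\<close>
lemma prob_measure_dominating_countable:
  assumes H: "sigma_algebra \<Omega> H" and "\<Omega> \<noteq> {}" and T: "countable T"
    and \<nu>: "\<And>t. t \<in> T \<Longrightarrow> \<nu> t \<in> countably_additive_in H"
  obtains P where "P \<in> prob_measures \<Omega> H" "\<And>t E. t \<in> T \<Longrightarrow> E \<in> null_sets P \<Longrightarrow> \<nu> t E = 0"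
proof -
  interpret H: sigma_algebra \<Omega> H by fact
  define f where "f = (\<lambda>n. if T = {} then 0 else \<nu> (from_nat_into T n))"
  have "(0::'a set \<Rightarrow> real) \<in> countably_additive_in H"
    using ba_0[of H] by (simp add: countably_additive_in_def)
  then have "f n \<in> countably_additive_in H" for n
    using \<nu>[OF from_nat_into] by (simp add: f_def)
  then have "\<exists>Q. prob_space Q \<and> sets Q = H \<and> (\<forall>E\<in>null_sets Q. f n E = 0)" for n
    by (rule prob_measure_dominating_one[OF H \<open>\<Omega> \<noteq> {}\<close>])
  then obtain Q where Q: "\<And>n. prob_space (Q n)" "\<And>n. sets (Q n) = H"
    "\<And>n E. E \<in> null_sets (Q n) \<Longrightarrow> f n E = 0" by metis
  let ?g = "measure_pmf (geometric_pmf (1 / 2))"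
  let ?S = "sigma \<Omega> H"
  define P where "P = ?g \<bind> Q"
  have g: "?g \<in> space (prob_algebra (count_space UNIV))"
    by (simp add: space_prob_algebra prob_space_measure_pmf)
  have kernel: "Q \<in> count_space UNIV \<rightarrow>\<^sub>M prob_algebra ?S"
    using Q by (simp add: space_prob_algebra Pi_iff)
  have P: "prob_space P" "sets P = H"
    unfolding P_def using prob_space_bind'[OF g kernel] sets_bind'[OF g kernel] by simp_all
  have "space P = \<Omega>"
    using sets_eq_imp_space_eq[of P ?S] P(2) H.space_closed by (simp add: space_measure_of_conv)
  then have "P \<in> prob_measures \<Omega> H" using P by (simp add: prob_measures_def)
  moreover have "\<nu> t E = 0" if t: "t \<in> T" and E: "E \<in> null_sets P" for t E
  proof -
    have EH: "E \<in> H" using E P(2) by auto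
    have "(\<integral>\<^sup>+n. emeasure (Q n) E \<partial>?g) = 0"
      using emeasure_bind_prob_algebra[OF g kernel, of E] EH null_setsD1[OF E] by (simp add: P_def)
    then have "AE n in ?g. emeasure (Q n) E = 0"
      by (subst (asm) nn_integral_0_iff_AE) auto
    then have "emeasure (Q n) E = 0" for n
      using set_pmf_geometric[of "1/2"] by (simp add: AE_measure_pmf_iff)
    then have f0: "f n E = 0" for n using EH Q(2)[of n] Q(3)[of E n] by (auto simp: null_sets_def)
    obtain n where "from_nat_into T n = t"
      using from_nat_into_surj[OF T t] by blast
    then have "f n = \<nu> t" using t by (auto simp: f_def)
    then show ?thesis using f0[of n] by simp
  qed
  ultimately show ?thesis using that by blast
qed

lemma set_integral_restr_to_subalg:
  fixes X :: "'a \<Rightarrow> real"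
  assumes "subalgebra P F" "X \<in> borel_measurable F" "E \<in> sets F"
  shows "(LINT \<omega>:E|restr_to_subalg P F. X \<omega>) = (LINT \<omega>:E|P. X \<omega>)"
  unfolding set_lebesgue_integral_def
  using assms by (intro integral_subalgebra2) auto

text \<open>The Radon--Nikodym theorem for the restriction of \<open>P\<close> to \<open>F\<close>.\<close>
lemma density_on_subalgebra:
  assumes P: "finite_measure P" and sub: "subalgebra P F" and N: "finite_measure N" "sets N = sets F"
    and ac: "\<And>E. E \<in> sets F \<Longrightarrow> E \<in> null_sets P \<Longrightarrow> emeasure N E = 0"
  obtains X :: "'a \<Rightarrow> real" where "X \<in> borel_measurable F" "integrable P X"
    "\<And>E. E \<in> sets F \<Longrightarrow> (LINT \<omega>:E|P. X \<omega>) = measure N E"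
proof -
  let ?R = "restr_to_subalg P F"
  have setsR: "sets ?R = sets F" by (rule sets_restr_to_subalg[OF sub])
  interpret R: finite_measure ?R by (rule finite_measure_restr_to_subalg[OF sub P])
  interpret N: finite_measure N by fact
  have sR: "sets N = sets ?R" using setsR N(2) by simp
  have acR: "absolutely_continuous ?R N"
    using ac N(2) null_sets_restr_to_subalg[OF sub]
    by (auto simp: absolutely_continuous_def null_sets_def[of N])
  obtain X where X: "X \<in> borel_measurable ?R" "AE x in ?R. RN_deriv ?R N x = ennreal (X x)" "\<And>x. 0 \<le> X x"
    using R.real_RN_deriv[OF N(1) acR sR] by metis
  have "density ?R (\<lambda>x. ennreal (X x)) = density ?R (RN_deriv ?R N)"
    using X by (intro density_cong) auto
  also have "\<dots> = N" by (rule R.density_RN_deriv[OF acR sR])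
  finally have dens: "density ?R (\<lambda>x. ennreal (X x)) = N" .
  have nni: "(\<integral>\<^sup>+x. ennreal (X x) * indicator E x \<partial>?R) = emeasure N E" if "E \<in> sets F" for E
    using X(1) that setsR by (subst dens[symmetric], subst emeasure_density) auto
  have XF: "X \<in> borel_measurable F"
    using X(1) measurable_cong_sets[OF setsR refl] by blast
  have "(\<integral>\<^sup>+x. ennreal (X x) \<partial>?R) = (\<integral>\<^sup>+x. ennreal (X x) * indicator (space F) x \<partial>?R)"
    using sub by (intro nn_integral_cong) (simp add: space_restr_to_subalg subalgebra_def)
  also have "\<dots> = emeasure N (space F)" by (rule nni[OF sets.top])
  finally have "(\<integral>\<^sup>+x. ennreal (X x) \<partial>?R) = emeasure N (space F)" .
  then have intR: "integrable ?R X"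
    using X by (intro integrableI_nonneg) (auto simp: N.emeasure_eq_measure)
  have "(LINT \<omega>:E|P. X \<omega>) = measure N E" if E: "E \<in> sets F" for E
  proof -
    have "(LINT \<omega>:E|P. X \<omega>) = (LINT \<omega>:E|?R. X \<omega>)"
      by (rule set_integral_restr_to_subalg[OF sub XF E, symmetric])
    also have "\<dots> = enn2real (\<integral>\<^sup>+x. ennreal (X x) * indicator E x \<partial>?R)"
    proof -
      have "(\<lambda>x. indicator E x *\<^sub>R X x) \<in> borel_measurable ?R"
        using X(1) E setsR by (intro borel_measurable_scaleR borel_measurable_indicator) auto
      moreover have "ennreal (indicator E x *\<^sub>R X x) = ennreal (X x) * indicator E x" for x
        by (cases "x \<in> E") auto
      ultimately show ?thesis
        unfolding set_lebesgue_integral_def using X(3) by (subst integral_eq_nn_integral) auto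
    qed
    also have "\<dots> = measure N E" using nni[OF E] by (simp add: measure_def)
    finally show ?thesis .
  qed
  then show ?thesis using that XF integrable_from_subalg[OF sub intR] by blast
qed

lemma real_cond_exp_le:
  fixes f g :: "'a \<Rightarrow> real"
  assumes P: "finite_measure P" and sub: "subalgebra P F"
    and f: "integrable P f" and g: "g \<in> borel_measurable F" "integrable P g"
    and le: "\<And>E. E \<in> sets F \<Longrightarrow> (LINT \<omega>:E|P. f \<omega>) \<le> (LINT \<omega>:E|P. g \<omega>)"
  shows "AE \<omega> in P. real_cond_exp P F f \<omega> \<le> g \<omega>"
proof -
  interpret finite_measure_subalgebra P F
    using P sub by (simp add: finite_measure_subalgebra_def finite_measure_subalgebra_axioms_def)
  let ?R = "restr_to_subalg P F" and ?c = "real_cond_exp P F f"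
  note setsR = sets_restr_to_subalg[OF sub]
  interpret R: finite_measure ?R by (rule finite_measure_restr_to_subalg[OF sub P])
  have c: "?c \<in> borel_measurable F" "integrable P ?c" using f by auto
  have gR: "integrable ?R g" and cR: "integrable ?R ?c"
    by (rule integrable_in_subalg[OF sub g], rule integrable_in_subalg[OF sub c])
  have "AE \<omega> in ?R. 0 \<le> g \<omega> - ?c \<omega>"
  proof (rule R.density_nonneg)
    fix E assume "E \<in> sets ?R"
    then have E: "E \<in> sets F" using setsR by simp
    have "(LINT \<omega>:E|?R. g \<omega> - ?c \<omega>) = (LINT \<omega>:E|?R. g \<omega>) - (LINT \<omega>:E|?R. ?c \<omega>)"
      using gR cR E setsR
      by (intro set_integral_diff; unfold set_integrable_def; intro integrable_mult_indicator) auto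
    also have "\<dots> = (LINT \<omega>:E|P. g \<omega>) - (LINT \<omega>:E|P. f \<omega>)"
      using set_integral_restr_to_subalg[OF sub _ E] g(1) c(1) real_cond_exp_intA[OF f E] by simp
    finally show "0 \<le> (LINT \<omega>:E|?R. g \<omega> - ?c \<omega>)" using le[OF E] by simp
  qed (use gR cR in auto)
  then show ?thesis using AE_restr_to_subalg[OF sub] by fastforce
qed

lemma set_integral_countably_additive_in:
  fixes X :: "'a \<Rightarrow> real"
  assumes X: "integrable P X"
  shows "(\<lambda>E. if E \<in> sets P then LINT \<omega>:E|P. X \<omega> else 0) \<in> countably_additive_in (sets P)"
proof -
  let ?\<nu> = "\<lambda>E. if E \<in> sets P then LINT \<omega>:E|P. X \<omega> else 0"
  have si: "set_integrable P E X" if "E \<in> sets P" for E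
    unfolding set_integrable_def using X that by (intro integrable_mult_indicator)
  have "\<bar>LINT \<omega>:E|P. X \<omega>\<bar> \<le> (LINT \<omega>|P. \<bar>X \<omega>\<bar>)" if E: "E \<in> sets P" for E
  proof -
    have "\<bar>LINT \<omega>:E|P. X \<omega>\<bar> \<le> (LINT \<omega>|P. \<bar>indicator E \<omega> *\<^sub>R X \<omega>\<bar>)"
      unfolding set_lebesgue_integral_def by (rule integral_abs_bound)
    also have "\<dots> \<le> (LINT \<omega>|P. \<bar>X \<omega>\<bar>)"
      using si[OF E] X by (intro integral_mono integrable_abs) (auto simp: set_integrable_def indicator_def)
    finally show ?thesis .
  qed
  then have "bounded (?\<nu> ` sets P)" by (auto simp: bounded_iff)
  moreover have "additive (sets P) ?\<nu>"
    using si by (auto simp: additive_def set_integral_Un)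
  ultimately have ba: "?\<nu> \<in> ba (sets P)" by (simp add: ba_def)
  have "(\<lambda>i. ?\<nu> (E i)) sums ?\<nu> (\<Union>i. E i)"
    if E: "range E \<subseteq> sets P" "disjoint_family E" for E :: "nat \<Rightarrow> 'a set"
  proof -
    have UN: "(\<Union>i<n. E i) \<in> sets P" for n using E(1) by auto
    have "(\<lambda>n. LINT \<omega>:(\<Union>i<n. E i)|P. X \<omega>) \<longlonglongrightarrow> (LINT \<omega>:(\<Union>n. \<Union>i<n. E i)|P. X \<omega>)"
      using UN si by (intro set_integral_cont_up incseq_SucI) (auto intro: less_SucI)
    moreover have "(\<Union>n. \<Union>i<n. E i) = (\<Union>i. E i)" by blast
    moreover have "(\<Union>i. E i) \<in> sets P" using E(1) by auto
    ultimately have "(\<lambda>n. ?\<nu> (\<Union>i<n. E i)) \<longlonglongrightarrow> ?\<nu> (\<Union>i. E i)" using UN by simp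
    then show ?thesis unfolding sums_def sets.sum_ba_disjoint[OF ba E] .
  qed
  then show ?thesis using ba by (simp add: countably_additive_in_def)
qed

section \<open>Representation of positive supermartingales\<close>

lemma algebra_subset_Pow: "algebra \<Omega> G \<Longrightarrow> G \<subseteq> Pow \<Omega>"
  by (simp add: algebra_iff_Un)

lemma sigma_infinity_contains:
  assumes "increasing_algebras \<Omega> A"
  shows "sigma_algebra \<Omega> (sigma_infinity \<Omega> A)"
    and "\<And>t. t \<ge> 0 \<Longrightarrow> algebra \<Omega> (A t)"
    and "\<And>t. t \<ge> 0 \<Longrightarrow> A t \<subseteq> sigma_infinity \<Omega> A"
    and "\<And>t. t \<ge> 0 \<Longrightarrow> sigma_sets \<Omega> (A t) \<subseteq> sigma_infinity \<Omega> A"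
proof -
  show alg: "algebra \<Omega> (A t)" if "t \<ge> 0" for t
    using assms that by (simp add: increasing_algebras_def)
  have "(\<Union>t\<in>{0..}. A t) \<subseteq> Pow \<Omega>"
    using algebra_subset_Pow[OF alg] by fastforce
  then show sa: "sigma_algebra \<Omega> (sigma_infinity \<Omega> A)"
    unfolding sigma_infinity_def by (rule sigma_algebra_sigma_sets)
  show sub: "A t \<subseteq> sigma_infinity \<Omega> A" if "t \<ge> 0" for t
    unfolding sigma_infinity_def using that by (intro subsetI sigma_sets.Basic) auto
  show "sigma_sets \<Omega> (A t) \<subseteq> sigma_infinity \<Omega> A" if "t \<ge> 0" for t
    by (rule sigma_algebra.sigma_sets_subset[OF sa sub[OF that]])
qed

lemma ca_of_represented_as:
  assumes A: "increasing_algebras \<Omega> A" and "t \<ge> 0" and \<eta>: "\<eta> t \<in> ba (A t)"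
    and rep: "represented_as \<Omega> A \<eta> P X"
  shows "\<eta> t \<in> ca (A t) (sigma_infinity \<Omega> A)"
proof -
  let ?\<nu> = "\<lambda>E. if E \<in> sets P then LINT \<omega>:E|P. X t \<omega> else 0"
  have P: "sets P = sigma_infinity \<Omega> A" "integrable P (X t)"
    and eq: "\<forall>E\<in>A t. \<eta> t E = (LINT \<omega>:E|P. X t \<omega>)"
    using rep \<open>t \<ge> 0\<close> by (auto simp: represented_as_def prob_measures_def supermartingale_def)
  have "?\<nu> \<in> countably_additive_in (sigma_infinity \<Omega> A)"
    using set_integral_countably_additive_in[OF P(2)] unfolding P(1) .
  moreover have "\<forall>E\<in>A t. ?\<nu> E = \<eta> t E"
    using eq sigma_infinity_contains(3)[OF A \<open>t \<ge> 0\<close>] P(1) by auto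
  ultimately show ?thesis using \<eta> by (auto simp: ca_def)
qed

text \<open>
  The difficulty is to dominate uncountably many set functions by a single \<open>P\<close>. With \<open>\<nu> t\<close> a
  countably additive extension of \<open>\<xi> t\<close>, let \<open>P\<close> dominate \<open>\<nu> t\<close> for rational \<open>t\<close> and for the
  countably many discontinuities \<open>t\<close> of the decreasing function \<open>t \<mapsto> \<xi> t \<Omega>\<close>. At any other
  \<open>t\<close>, choose a rational \<open>u > t\<close> close to \<open>t\<close>: on \<open>\<sigma>(A t)\<close> the difference \<open>\<nu> t - \<nu> u\<close> is
  positive with small mass \<open>\<xi> t \<Omega> - \<xi> u \<Omega>\<close>, so \<open>P\<close>-null sets of \<open>\<sigma>(A t)\<close> are \<open>\<nu> t\<close>-null.
\<close>
lemma representable_supermartingale: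
  fixes A :: "real \<Rightarrow> 'a set set"
  assumes ne: "\<Omega> \<noteq> {}" and A: "increasing_algebras \<Omega> A"
    and super: "fa_supermartingale A \<xi>" and pos: "0 \<le> \<xi>"
    and ca: "\<And>t. t \<ge> 0 \<Longrightarrow> \<xi> t \<in> ca (A t) (sigma_infinity \<Omega> A)"
  shows "representable \<Omega> A \<xi>"
proof -
  let ?H = "sigma_infinity \<Omega> A" and ?S = "\<lambda>t. sigma_sets \<Omega> (A t)"
  note facts = sigma_infinity_contains[OF A]
  note H = facts(1) and alg = facts(2) and AH = facts(3) and SH = facts(4)
  interpret H: sigma_algebra \<Omega> ?H by (rule H)
  have AS: "A t \<subseteq> ?S t" for t by (auto intro: sigma_sets.Basic)
  have mono: "A t \<subseteq> A u" if "0 \<le> t" "t \<le> u" for t u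
    using A that by (auto simp: increasing_algebras_def)
  have \<Omega>A: "\<Omega> \<in> A t" if "t \<ge> 0" for t using algebra.top[OF alg[OF that]] .
  have "\<forall>t. \<exists>\<nu>. t \<ge> 0 \<longrightarrow> \<nu> \<in> countably_additive_in ?H \<and> (\<forall>E\<in>A t. \<nu> E = \<xi> t E)"
    using ca unfolding ca_def by blast
  then obtain \<nu> where \<nu>: "\<And>t. t \<ge> 0 \<Longrightarrow> \<nu> t \<in> countably_additive_in ?H"
    "\<And>t E. t \<ge> 0 \<Longrightarrow> E \<in> A t \<Longrightarrow> \<nu> t E = \<xi> t E" by metis
  have nonneg: "0 \<le> \<nu> t E" if "t \<ge> 0" "E \<in> ?S t" for t E
  proof (rule nonneg_on_sigma_sets[OF H alg[OF that(1)] AH[OF that(1)] \<nu>(1)[OF that(1)] _ that(2)])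
    fix E assume "E \<in> A t"
    then show "0 \<le> \<nu> t E"
      using \<nu>(2)[OF that(1)] le_funD[OF le_funD[OF pos], of t E] by simp
  qed
  have decr: "\<nu> u E \<le> \<nu> t E" if tu: "0 \<le> t" "t \<le> u" and E: "E \<in> ?S t" for t u E
  proof -
    have "0 \<le> (\<nu> t - \<nu> u) E"
    proof (rule nonneg_on_sigma_sets[OF H alg[OF tu(1)] AH[OF tu(1)] _ _ E])
      show "\<nu> t - \<nu> u \<in> countably_additive_in ?H"
        using countably_additive_in_plus[OF \<nu>(1) countably_additive_in_uminus[OF \<nu>(1)], of t u] tu
        by simp
      fix E assume "E \<in> A t"
      moreover from this have "\<xi> u E \<le> \<xi> t E" using super tu by (auto simp: fa_supermartingale_def)
      ultimately show "0 \<le> (\<nu> t - \<nu> u) E" using \<nu>(2) mono[OF tu] tu by auto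
    qed
    then show ?thesis by simp
  qed

  \<comment> \<open>Negated so that it increases, and constant at negative times so that it does so on the whole line.\<close>
  define m where "m t = - \<xi> (max t 0) \<Omega>" for t
  have "mono m"
    using super \<Omega>A by (auto intro!: monoI simp: m_def fa_supermartingale_def)
  define T where "T = {t. t \<ge> 0 \<and> (t \<in> \<rat> \<or> \<not> isCont m t)}"
  have "countable T"
    using countable_rat mono_ctble_discont[OF \<open>mono m\<close>]
    by (rule countable_subset[OF _ countable_Un, rotated]) (auto simp: T_def)
  moreover have "\<nu> t \<in> countably_additive_in ?H" if "t \<in> T" for t
    using \<nu>(1) that by (simp add: T_def)
  ultimately obtain P where P: "P \<in> prob_measures \<Omega> ?H"
    and PT: "\<And>t E. t \<in> T \<Longrightarrow> E \<in> null_sets P \<Longrightarrow> \<nu> t E = 0"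
    using prob_measure_dominating_countable[OF H ne, of T \<nu>] by metis
  have Pp: "prob_space P" "space P = \<Omega>" "sets P = ?H" using P by (auto simp: prob_measures_def)
  interpret P: prob_space P by (rule Pp(1))

  have ac: "\<nu> t E = 0" if t: "t \<ge> 0" and E: "E \<in> ?S t" "E \<in> null_sets P" for t E
  proof (cases "t \<in> T")
    case True
    then show ?thesis using PT E by blast
  next
    case False
    then have "isCont m t" using t by (simp add: T_def)
    have "\<nu> t E \<le> 0"
    proof (rule field_le_epsilon)
      fix \<epsilon> :: real assume "\<epsilon> > 0"
      then obtain d where d: "d > 0" "\<And>x. \<bar>x - t\<bar> < d \<Longrightarrow> \<bar>m x - m t\<bar> < \<epsilon>"
        using \<open>isCont m t\<close> unfolding continuous_at_eps_delta dist_real_def by metis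
      obtain u where u: "u \<in> \<rat>" "t < u" "u < t + d"
        using Rats_dense_in_real[of t "t + d"] d(1) by auto
      have u0: "0 \<le> u" "t \<le> u" using t u by auto
      have "u \<in> T" using u t by (simp add: T_def)
      then have "\<nu> u E = 0" using PT E by blast
      have "E \<subseteq> \<Omega>" using E(1) sigma_sets_into_sp[OF algebra_subset_Pow[OF alg[OF t]]] by blast
      have "\<Omega> - E \<in> ?S t" using E(1) by (rule sigma_sets.Compl)
      moreover have "\<nu> s (\<Omega> - E) = \<nu> s \<Omega> - \<nu> s E" if "s \<ge> 0" for s
        using SH[OF t] E(1) \<open>E \<subseteq> \<Omega>\<close>
        by (intro H.ba_Diff countably_additive_in_ba \<nu>(1) that) auto
      ultimately have "\<nu> u \<Omega> - \<nu> u E \<le> \<nu> t \<Omega> - \<nu> t E"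
        using decr[OF t u0(2)] t u0(1) by metis
      moreover have "\<nu> t \<Omega> - \<nu> u \<Omega> \<le> \<bar>m u - m t\<bar>"
        using \<nu>(2)[OF _ \<Omega>A] t u0 by (simp add: m_def)
      moreover have "\<bar>m u - m t\<bar> < \<epsilon>" using u by (intro d(2)) simp
      ultimately show "\<nu> t E \<le> 0 + \<epsilon>" using \<open>\<nu> u E = 0\<close> by simp
    qed
    then show ?thesis using nonneg[OF t E(1)] by simp
  qed

  let ?F = "\<lambda>t. sigma \<Omega> (A t)"
  have spF: "space (?F t) = \<Omega>" and setsF: "sets (?F t) = ?S t" if "t \<ge> 0" for t
    using algebra_subset_Pow[OF alg[OF that]] by (simp_all add: space_measure_of_conv)
  have subF: "subalgebra P (?F t)" if "t \<ge> 0" for t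
    using spF[OF that] setsF[OF that] SH[OF that] Pp by (auto simp: subalgebra_def)
  have "\<exists>X. X \<in> borel_measurable (?F t) \<and> integrable P X \<and> (\<forall>E\<in>?S t. (LINT \<omega>:E|P. X \<omega>) = \<nu> t E)"
    if t: "t \<ge> 0" for t
  proof -
    let ?n = "\<lambda>E. if E \<in> ?S t then \<nu> t E else 0"
    have S: "sigma_algebra \<Omega> (?S t)"
      by (rule sigma_algebra_sigma_sets[OF algebra_subset_Pow[OF alg[OF t]]])
    then have "?n \<in> countably_additive_in (?S t)"
      by (intro countably_additive_in_restrict[OF \<nu>(1)[OF t] SH[OF t]] sigma_algebra.axioms(1))
    moreover have "0 \<le> ?n" using nonneg[OF t] by (simp add: le_fun_def)
    ultimately obtain N where N: "finite_measure N" "space N = \<Omega>" "sets N = ?S t"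
      "\<And>E. E \<in> ?S t \<Longrightarrow> emeasure N E = ennreal (?n E)" "\<And>E. E \<in> ?S t \<Longrightarrow> measure N E = ?n E"
      using measure_of_countably_additive_in[OF S, of ?n] by metis
    have "sets N = sets (?F t)" using N(3) setsF[OF t] by simp
    moreover have "emeasure N E = 0" if "E \<in> sets (?F t)" "E \<in> null_sets P" for E
      using that ac[OF t] N(4) setsF[OF t] by simp
    ultimately obtain X where "X \<in> borel_measurable (?F t)" "integrable P X"
      "\<And>E. E \<in> sets (?F t) \<Longrightarrow> (LINT \<omega>:E|P. X \<omega>) = measure N E"
      using density_on_subalgebra[OF P.finite_measure_axioms subF[OF t] N(1)] by metis
    then show ?thesis using N(5) setsF[OF t] by (intro exI[of _ X]) auto
  qed
  then have "\<forall>t. \<exists>X. t \<ge> 0 \<longrightarrow> X \<in> borel_measurable (?F t) \<and> integrable P X \<and>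
      (\<forall>E\<in>?S t. (LINT \<omega>:E|P. X \<omega>) = \<nu> t E)" by blast
  then obtain X where X: "\<And>t. t \<ge> 0 \<Longrightarrow> X t \<in> borel_measurable (?F t)"
    "\<And>t. t \<ge> 0 \<Longrightarrow> integrable P (X t)"
    "\<And>t E. t \<ge> 0 \<Longrightarrow> E \<in> ?S t \<Longrightarrow> (LINT \<omega>:E|P. X t \<omega>) = \<nu> t E" by metis
  have "AE \<omega> in P. real_cond_exp P (?F s) (X t) \<omega> \<le> X s \<omega>" if st: "0 \<le> s" "s \<le> t" for s t
  proof (rule real_cond_exp_le[OF P.finite_measure_axioms subF])
    fix E assume "E \<in> sets (?F s)"
    then have E: "E \<in> ?S s" using setsF[OF st(1)] by simp
    then have "E \<in> ?S t" using sigma_sets_mono'[OF mono[OF st]] by blast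
    then show "(LINT \<omega>:E|P. X t \<omega>) \<le> (LINT \<omega>:E|P. X s \<omega>)"
      using X(3) E decr[OF st E] st by simp
  qed (use X st in auto)
  then have "supermartingale P ?F X" using X by (simp add: supermartingale_def)
  moreover have "\<xi> t E = (LINT \<omega>:E|P. X t \<omega>)" if "t \<ge> 0" "E \<in> A t" for t E
    using X(3) \<nu>(2) AS that by auto
  ultimately show ?thesis using P by (auto simp: representable_def represented_as_def)
qed

section \<open>The decomposition\<close>

theorem proposition1:
  fixes \<Omega> :: "'a set"
    and A :: "real \<Rightarrow> 'a set set"
    and \<xi> \<xi>\<^sub>e \<xi>\<^sub>p :: "real \<Rightarrow> 'a set \<Rightarrow> real"
  assumes "\<Omega> \<noteq> {}"
    and "increasing_algebras \<Omega> A"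
    and "\<xi> \<in> \<SS>\<^sub>+ A"
    and "\<xi>\<^sub>e \<in> fa_processes A" and "\<xi>\<^sub>p \<in> fa_processes A"
    and "\<And>t. t \<ge> 0 \<Longrightarrow> \<xi> t = \<xi>\<^sub>e t + \<xi>\<^sub>p t"
    and "\<And>t. t \<ge> 0 \<Longrightarrow> \<xi>\<^sub>e t \<in> ca (A t) (sigma_infinity \<Omega> A)"
    and "\<And>t. t \<ge> 0 \<Longrightarrow> \<xi>\<^sub>p t \<in> pfa (A t) (sigma_infinity \<Omega> A)"
  shows "classical_decomposition \<Omega> A \<xi> \<xi>\<^sub>e \<xi>\<^sub>p \<and>
    (\<forall>\<alpha> \<beta>. classical_decomposition \<Omega> A \<xi> \<alpha> \<beta> \<longrightarrow> \<alpha> = \<xi>\<^sub>e \<and> \<beta> = \<xi>\<^sub>p)"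
proof -
  note ne = assms(1) and A = assms(2) and \<xi> = assms(3) and e = assms(4) and p = assms(5)
    and split = assms(6) and ca = assms(7) and pfa = assms(8)
  let ?H = "sigma_infinity \<Omega> A"
  note facts = sigma_infinity_contains[OF A]
  note alg = facts(2) and AH = facts(3)
  have Halg: "algebra \<Omega> ?H" using facts(1) by (rule sigma_algebra.axioms(1))
  have super: "fa_supermartingale A \<xi>"
    and bdd: "bdd_above ((\<lambda>t. tv_norm (A t) (\<xi> t)) ` {0..})" and pos: "0 \<le> \<xi>"
    using \<xi> by (auto simp: positive_bounded_fa_supermartingales_def bounded_fa_supermartingales_def)
  have \<xi>_proc: "\<xi> \<in> fa_processes A" using super by (simp add: fa_supermartingale_def)
  have ba: "\<eta> t \<in> ba (A t)" if "\<eta> \<in> fa_processes A" "t \<ge> 0" for \<eta> t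
    using that by (simp add: fa_processes_def)
  have mono: "A t \<subseteq> A u" if "0 \<le> t" "t \<le> u" for t u
    using A that by (auto simp: increasing_algebras_def)
  have proc_le: "\<eta> \<le> \<zeta>"
    if "\<eta> \<in> fa_processes A" "\<zeta> \<in> fa_processes A" "\<And>t. t \<ge> 0 \<Longrightarrow> \<eta> t \<le> \<zeta> t" for \<eta> \<zeta>
  proof -
    have "\<eta> t \<le> \<zeta> t" for t
      using that by (cases "t \<ge> 0") (simp_all add: fa_processes_def)
    then show ?thesis by (simp add: le_fun_def[of \<eta>])
  qed
  have zero: "0 \<in> fa_processes A" by (simp add: fa_processes_def ba_0)

  have orth: "orthogonal_in (ba (A t)) \<mu> (\<xi>\<^sub>p t)" if "t \<ge> 0" "\<mu> \<in> ca (A t) ?H" for t \<mu>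
    by (intro algebra.orthogonal_in_ba_sym[OF alg[OF that(1)] ba[OF p that(1)] ca_ba[OF that(2)]]
        pfa_orthogonal_ca[OF alg[OF that(1)] Halg AH[OF that(1)] pfa[OF that(1)] that(2)])
  have split': "\<xi> t E = \<xi>\<^sub>e t E + \<xi>\<^sub>p t E" if "t \<ge> 0" for t E using split[OF that] by simp
  have posE: "0 \<le> \<xi> t E" for t E using pos by (simp add: le_fun_def)
  have e_t: "0 \<le> \<xi>\<^sub>e t" if t: "t \<ge> 0" for t
  proof -
    interpret algebra \<Omega> "A t" by (rule alg[OF t])
    have "- \<xi>\<^sub>e t \<le> 0"
    proof (rule le_of_le_plus_orthogonal[OF ba_uminus[OF ba[OF e t]] ba_0 order_refl ba[OF p t]])
      show "orthogonal_in (ba (A t)) (- \<xi>\<^sub>e t) (\<xi>\<^sub>p t)"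
        using orthogonal_in_ba_uminus[OF ba[OF e t] ba[OF p t]] orth[OF t ca[OF t]] by blast
      show "(- \<xi>\<^sub>e t) E \<le> 0 E + \<xi>\<^sub>p t E" for E
        using split'[OF t, of E] posE[of t E] by simp
    qed
    then show ?thesis by (auto simp: le_fun_def)
  qed
  have p_t: "0 \<le> \<xi>\<^sub>p t" if t: "t \<ge> 0" for t
  proof -
    interpret algebra \<Omega> "A t" by (rule alg[OF t])
    have "- \<xi>\<^sub>p t \<le> 0"
    proof (rule le_of_le_plus_orthogonal[OF ba_uminus[OF ba[OF p t]] ba_0 order_refl ba[OF e t]])
      show "orthogonal_in (ba (A t)) (- \<xi>\<^sub>p t) (\<xi>\<^sub>e t)"
        using orthogonal_in_ba_uminus[OF ba[OF p t] ba[OF e t]]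
          orthogonal_in_ba_sym[OF ba[OF e t] ba[OF p t] orth[OF t ca[OF t]]] by blast
      show "(- \<xi>\<^sub>p t) E \<le> 0 E + \<xi>\<^sub>e t E" for E
        using split'[OF t, of E] posE[of t E] by simp
    qed
    then show ?thesis by (auto simp: le_fun_def)
  qed
  have e_pos: "0 \<le> \<xi>\<^sub>e" and p_pos: "0 \<le> \<xi>\<^sub>p"
    using e_t p_t proc_le[OF zero e] proc_le[OF zero p] by simp_all

  \<comment> \<open>The restriction of \<open>\<xi>\<^sub>e u\<close> to the smaller algebra \<open>A t\<close> is still orthogonal to \<open>\<xi>\<^sub>p t\<close>.\<close>
  have e_decr: "\<xi>\<^sub>e u E \<le> \<xi>\<^sub>e t E" if tu: "0 \<le> t" "t \<le> u" and E: "E \<in> A t" for t u E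
  proof -
    have u: "u \<ge> 0" using tu by simp
    interpret algebra \<Omega> "A t" by (rule alg[OF tu(1)])
    let ?r = "\<lambda>E. if E \<in> A t then \<xi>\<^sub>e u E else 0"
    have r: "?r \<in> ba (A t)"
      by (rule ba_restrict[OF ba[OF e u] mono[OF tu] alg[OF tu(1)]])
    obtain \<nu> where \<nu>: "\<nu> \<in> countably_additive_in ?H" "\<forall>E\<in>A u. \<nu> E = \<xi>\<^sub>e u E"
      using ca[OF u] by (auto simp: ca_def)
    then have "\<forall>E\<in>A t. \<nu> E = ?r E" using mono[OF tu] by auto
    then have "?r \<in> ca (A t) ?H" using r \<nu>(1) by (auto simp: ca_def)
    note o = orth[OF tu(1) this]
    have "?r \<le> \<xi>\<^sub>e t"
    proof (rule le_of_le_plus_orthogonal[OF r ba[OF e tu(1)] e_t[OF tu(1)] ba[OF p tu(1)] o])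
      fix E assume E: "E \<in> A t"
      have "\<xi>\<^sub>e u E \<le> \<xi> u E" using split'[OF u, of E] le_funD[OF p_t[OF u], of E] by simp
      also have "\<dots> \<le> \<xi> t E" using super tu E by (auto simp: fa_supermartingale_def)
      finally show "?r E \<le> \<xi>\<^sub>e t E + \<xi>\<^sub>p t E" using E split'[OF tu(1)] by simp
    qed
    then show ?thesis using E le_funD[of ?r "\<xi>\<^sub>e t" E] by simp
  qed
  then have e_super: "fa_supermartingale A \<xi>\<^sub>e" using e by (simp add: fa_supermartingale_def)
  have norm_le: "tv_norm (A t) (\<xi>\<^sub>e t) \<le> tv_norm (A t) (\<xi> t)" if t: "t \<ge> 0" for t
  proof -
    interpret algebra \<Omega> "A t" by (rule alg[OF t])
    have "0 \<le> \<xi> t" using posE by (simp add: le_fun_def)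
    then show ?thesis
      using split'[OF t, of \<Omega>] le_funD[OF p_t[OF t], of \<Omega>]
      by (simp add: tv_norm_eq_variation ba[OF e t] ba[OF \<xi>_proc t] variation_of_nonneg e_t[OF t])
  qed
  have "bdd_above ((\<lambda>t. tv_norm (A t) (\<xi>\<^sub>e t)) ` {0..})"
  proof -
    obtain B where "\<And>t. t \<ge> 0 \<Longrightarrow> tv_norm (A t) (\<xi> t) \<le> B"
      using bdd by (auto simp: bdd_above_def)
    then show ?thesis using norm_le by (intro bdd_aboveI2[where M=B]) (auto intro: order_trans)
  qed
  then have e_SS: "\<xi>\<^sub>e \<in> \<SS>\<^sub>+ A"
    using e_super e_pos by (simp add: positive_bounded_fa_supermartingales_def bounded_fa_supermartingales_def)
  have e_rep: "representable \<Omega> A \<xi>\<^sub>e"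
    by (rule representable_supermartingale[OF ne A e_super e_pos ca])
  have rep_ca: "\<eta> t \<in> ca (A t) ?H" if "\<eta> \<in> fa_processes A" "representable \<Omega> A \<eta>" "t \<ge> 0" for \<eta> t
    using ca_of_represented_as[OF A that(3), of \<eta>] ba[OF that(1,3)] that(2)
    by (auto simp: representable_def)
  have p_orth: "orthogonal_in (fa_processes A) \<xi>\<^sub>p \<eta>"
    if \<eta>: "\<eta> \<in> fa_processes A" "representable \<Omega> A \<eta>" for \<eta>
  proof -
    have "orthogonal_in (ba (A t)) (\<xi>\<^sub>p t) (\<eta> t)" if t: "t \<ge> 0" for t
      by (rule pfa_orthogonal_ca[OF alg[OF t] Halg AH[OF t] pfa[OF t] rep_ca[OF \<eta> t]])
    then show ?thesis using orthogonal_in_fa_processes_iff[OF alg p \<eta>(1)] by blast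
  qed
  have eq: "\<xi> = \<xi>\<^sub>e + \<xi>\<^sub>p"
  proof
    fix t show "\<xi> t = (\<xi>\<^sub>e + \<xi>\<^sub>p) t"
      using split \<xi>_proc e p by (cases "t \<ge> 0") (simp_all add: fa_processes_def)
  qed
  have "classical_decomposition \<Omega> A \<xi> \<xi>\<^sub>e \<xi>\<^sub>p"
    using eq e_SS e_rep p p_pos p_orth by (simp add: classical_decomposition_def)
  moreover have "\<alpha> = \<xi>\<^sub>e \<and> \<beta> = \<xi>\<^sub>p" if d: "classical_decomposition \<Omega> A \<xi> \<alpha> \<beta>" for \<alpha> \<beta>
  proof -
    have \<xi>_eq: "\<xi> = \<alpha> + \<beta>" and \<alpha>: "\<alpha> \<in> fa_processes A" "representable \<Omega> A \<alpha>" "0 \<le> \<alpha>"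
      and \<beta>: "\<beta> \<in> fa_processes A" "0 \<le> \<beta>"
      "\<And>\<eta>. \<eta> \<in> fa_processes A \<Longrightarrow> representable \<Omega> A \<eta> \<Longrightarrow> orthogonal_in (fa_processes A) \<beta> \<eta>"
      using d by (auto simp: classical_decomposition_def positive_bounded_fa_supermartingales_def
          bounded_fa_supermartingales_def fa_supermartingale_def)
    have \<alpha>\<beta>: "\<alpha> t E + \<beta> t E = \<xi>\<^sub>e t E + \<xi>\<^sub>p t E" for t E
      using fun_cong[OF fun_cong[OF \<xi>_eq[unfolded eq], of t], of E] by simp
    have nonneg: "0 \<le> \<alpha> t E" "0 \<le> \<beta> t E" "0 \<le> \<xi>\<^sub>e t E" "0 \<le> \<xi>\<^sub>p t E" for t E
      using \<alpha>(3) \<beta>(2) e_pos p_pos by (simp_all add: le_fun_def)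
    have "\<alpha> t \<le> \<xi>\<^sub>e t" if t: "t \<ge> 0" for t
    proof (rule algebra.le_of_le_plus_orthogonal[OF alg[OF t] ba[OF \<alpha>(1) t] ba[OF e t] e_t[OF t]
          ba[OF p t] orth[OF t rep_ca[OF \<alpha>(1,2) t]]])
      show "\<alpha> t E \<le> \<xi>\<^sub>e t E + \<xi>\<^sub>p t E" for E
        using \<alpha>\<beta>[of t E] nonneg(2)[of t E] by linarith
    qed
    then have "\<alpha> \<le> \<xi>\<^sub>e" by (rule proc_le[OF \<alpha>(1) e])
    moreover have "\<xi>\<^sub>e t \<le> \<alpha> t" if t: "t \<ge> 0" for t
    proof -
      have "\<forall>t\<ge>0. orthogonal_in (ba (A t)) (\<beta> t) (\<xi>\<^sub>e t)"
        using \<beta>(3)[OF e e_rep] by (simp only: orthogonal_in_fa_processes_iff[OF alg \<beta>(1) e])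
      then have "orthogonal_in (ba (A t)) (\<beta> t) (\<xi>\<^sub>e t)" using t by simp
      then have o: "orthogonal_in (ba (A t)) (\<xi>\<^sub>e t) (\<beta> t)"
        by (rule algebra.orthogonal_in_ba_sym[OF alg[OF t] ba[OF \<beta>(1) t] ba[OF e t]])
      have \<alpha>t: "0 \<le> \<alpha> t" using nonneg(1) by (simp add: le_fun_def)
      show ?thesis
      proof (rule algebra.le_of_le_plus_orthogonal[OF alg[OF t] ba[OF e t] ba[OF \<alpha>(1) t] \<alpha>t
            ba[OF \<beta>(1) t] o])
        show "\<xi>\<^sub>e t E \<le> \<alpha> t E + \<beta> t E" for E
          using \<alpha>\<beta>[of t E] nonneg(4)[of t E] by linarith
      qed
    qed
    then have "\<xi>\<^sub>e \<le> \<alpha>" by (rule proc_le[OF e \<alpha>(1)])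
    ultimately have "\<alpha> = \<xi>\<^sub>e" by (rule antisym)
    moreover from this have "\<beta> = \<xi>\<^sub>p" using \<alpha>\<beta> by (simp add: fun_eq_iff)
    ultimately show ?thesis by blast
  qed
  ultimately show ?thesis by blast
qed

end
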